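(* For any parameters $0<\delta\le 0.5$ and $0<\varepsilon\le 1$, there is a randomized, comparison-based, one-pass streaming algorithm that, on a stream of $n$ items from a totally ordered universe $\mathcal{U}$, computes a sketch consisting of $O\big(\varepsilon^{-1}\log^2(\varepsilon n)\log\log(1/\delta)\big)$ universe items, from which an estimate $\hat{\operatorname{R}}(y)$ of $\operatorname{R}(y)$ can be derived for every $y\in\mathcal{U}$, such that for any fixed $y\in\mathcal{U}$, with probability at least $1-\delta$, $|\hat{\operatorname{R}}(y)-\operatorname{R}(y)|\le\varepsilon\operatorname{R}(y)$.
   Context: For a stream $x_1,\dots,x_n$ of items from a totally ordered universe $\mathcal{U}$ and $y\in\mathcal{U}$, the rank is $\operatorname{R}(y)=|\{i:x_i\le y\}|$. Comparison-based means items are accessed only via comparisons. The probability is over the internal randomness of the algorithm. *)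

theory Defs
  imports "HOL-Probability.Probability"
begin

definition stream_rank :: "'a::linorder list \<Rightarrow> 'a \<Rightarrow> nat" where
  "stream_rank xs y = card {i. i < length xs \<and> xs ! i \<le> y}"

text \<open>
  The only information about items that an algorithm receives: slots are compared by their
  index. The oracle answers False outside the memory, so nothing depends on the value of
  an out-of-range list access.
\<close>

definition compare_slots :: "'a::linorder list \<Rightarrow> nat \<Rightarrow> nat \<Rightarrow> bool" where
  "compare_slots xs i j \<longleftrightarrow> i < length xs \<and> j < length xs \<and> xs ! i \<le> xs ! j"

definition select_slots :: "'a list \<Rightarrow> nat list \<Rightarrow> 'a list" where
  "select_slots xs ks = map (\<lambda>i. xs ! i) (filter (\<lambda>i. i < length xs) ks)"

text \<open>
  A randomized comparison-based one-pass streaming algorithm. The type does not mention the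
  universe: items live in a separate memory, while the algorithm itself sees a control state
  (a finite bit string coded as a natural number) and a comparison oracle. On arrival of
  an item, slot 0 holds the new item and slots 1, 2, ... hold the items currently stored; the
  algorithm randomly chooses the next control state and the list of slots that are kept. The
  item is not available again unless it is kept. At query time slot 0 holds the queried element.
\<close>

record comparison_algorithm =
  start_control :: nat
  step :: "nat \<Rightarrow> (nat \<Rightarrow> nat \<Rightarrow> bool) \<Rightarrow> (nat \<times> nat list) pmf"
  estimator :: "nat \<Rightarrow> (nat \<Rightarrow> nat \<Rightarrow> bool) \<Rightarrow> real"

type_synonym 'a sketch = "nat \<times> 'a list"

definition process_item ::
    "comparison_algorithm \<Rightarrow> 'a::linorder \<Rightarrow> 'a sketch \<Rightarrow> 'a sketch pmf" where
  "process_item A x s =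
     map_pmf (\<lambda>(c, ks). (c, select_slots (x # snd s) ks))
       (step A (fst s) (compare_slots (x # snd s)))"

primrec process_stream ::
    "comparison_algorithm \<Rightarrow> 'a::linorder list \<Rightarrow> 'a sketch \<Rightarrow> 'a sketch pmf" where
  "process_stream A [] s = return_pmf s"
| "process_stream A (x # xs) s = bind_pmf (process_item A x s) (process_stream A xs)"

definition sketch_of :: "comparison_algorithm \<Rightarrow> 'a::linorder list \<Rightarrow> 'a sketch pmf" where
  "sketch_of A xs = process_stream A xs (start_control A, [])"

definition sketch_items :: "'a sketch \<Rightarrow> nat" where
  "sketch_items s = length (snd s)"

definition rank_estimate :: "comparison_algorithm \<Rightarrow> 'a::linorder sketch \<Rightarrow> 'a \<Rightarrow> real" where
  "rank_estimate A s y = estimator A (fst s) (compare_slots (y # snd s))"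

text \<open>
  The argument of the O-bound, as a function of \<open>\<epsilon>\<close>, \<open>\<delta>\<close> and the stream length.
  Each logarithmic factor is read as at least 1: taken literally, the bound would be 0 at
  \<open>\<epsilon> n = 1\<close> or \<open>\<delta> = 1/2\<close>. For \<open>\<epsilon> n \<ge> 2\<close> and \<open>\<delta> \<le> 1/4\<close> the truncation has no effect.
\<close>

definition sketch_bound :: "real \<Rightarrow> real \<Rightarrow> nat \<Rightarrow> real" where
  "sketch_bound \<epsilon> \<delta> n =
     (1 / \<epsilon>) * (max 1 (log 2 (\<epsilon> * real n)))\<^sup>2 * max 1 (log 2 (log 2 (1 / \<delta>)))"

end

theory Submission
  imports Defs
begin

text \<open>
  The sketch is a tower of compactors in which an item on level h stands for 2^h items of the
  stream. A full buffer keeps its smallest items, and every other one of the remaining items,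
  starting with the first or the second according to a fair coin, moves up one level. How many
  items are kept is governed by a binary counter, so that a compaction that affects the rank
  of y can be charged to k distinct items not exceeding y on that level.

  For fixed y, an affected level h contributes an error of plus or minus 2^h per charged
  compaction. Its moment generating function at a parameter lam is at most
  exp (min x (x^2 / 2)), with x proportional to lam 2^h: the quadratic bound controls the low
  levels, where the errors average out, and the linear one the O(log log (1 / delta)) levels
  below the first level whose compactions no longer reach y. Depositing these costs on the
  items that pay for them turns exp (lam * estimate) and exp (- lam * estimate) into
  supermartingales. Levels on which y should never be reached need no separate event: reaching
  them already makes the first of the two exceed its threshold, so the combination is cut off at 1.
\<close>

section \<open>Compactors\<close>

type_synonym 'b level = "bool list \<times> 'b list"

text \<open>Binary counters are lists of bits, least significant bit first.\<close>

fun increment :: "bool list \<Rightarrow> bool list" where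
  "increment [] = [True]"
| "increment (False # bs) = True # bs"
| "increment (True # bs) = False # increment bs"

fun counter_value :: "bool list \<Rightarrow> nat" where
  "counter_value [] = 0"
| "counter_value (b # bs) = of_bool b + 2 * counter_value bs"

definition trailing_ones :: "bool list \<Rightarrow> nat" where
  "trailing_ones bs = length (takeWhile id bs)"

text \<open>From a buffer of exactly \<open>k * (2 * length bs + 2)\<close> items,
  \<open>trailing_ones bs + 1\<close> blocks of k items leave. Deep compactions are thus as rare as
  long carries of the counter.\<close>

definition kept :: "bool list \<Rightarrow> nat" where
  "kept bs = 2 * length bs + 1 - trailing_ones bs"

fun alternate :: "bool \<Rightarrow> 'b list \<Rightarrow> 'b list" where
  "alternate c [] = []"
| "alternate True (x # xs) = x # alternate False xs"
| "alternate False (x # xs) = alternate True xs"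

text \<open>
  The sorting function is a parameter because the algorithm itself runs on slot numbers, sorted
  by means of the comparison oracle, while the analysis runs on the items.
\<close>

fun feed :: "('b list \<Rightarrow> 'b list) \<Rightarrow> nat \<Rightarrow> 'b list \<Rightarrow> 'b level list \<Rightarrow> 'b level list pmf" where
  "feed srt k xs [] = return_pmf [([], xs)]"
| "feed srt k xs ((bs, b) # ls) =
     (if length (b @ xs) < k * (2 * length bs + 2) then return_pmf ((bs, b @ xs) # ls)
      else bind_pmf (bernoulli_pmf (1/2)) (\<lambda>c.
        map_pmf (Cons (increment bs, take (k * kept bs) (srt (b @ xs))))
          (feed srt k (alternate c (drop (k * kept bs) (srt (b @ xs)))) ls)))"

primrec run :: "nat \<Rightarrow> 'a::linorder list \<Rightarrow> 'a level list \<Rightarrow> 'a level list pmf" where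
  "run k [] ls = return_pmf ls"
| "run k (x # xs) ls = bind_pmf (feed sort k [x] ls) (run k xs)"

section \<open>Elementary facts about the counter and alternating selection\<close>

lemma trailing_ones_le: "trailing_ones bs \<le> length bs"
  by (simp add: trailing_ones_def length_takeWhile_le)

lemma kept_ge: "length bs + 1 \<le> kept bs"
  using trailing_ones_le[of bs] by (simp add: kept_def)

lemma kept_le: "kept bs \<le> 2 * length bs + 1"
  by (simp add: kept_def)

lemma counter_value_increment [simp]: "counter_value (increment bs) = Suc (counter_value bs)"
  by (induction bs rule: increment.induct) auto

lemma increment_neq_Nil [simp]: "increment bs \<noteq> []"
  by (cases bs rule: increment.cases) auto

lemma length_increment:
  "length (increment bs) = length bs \<or>
   trailing_ones bs = length bs \<and> length (increment bs) = Suc (length bs) \<and>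
   counter_value (increment bs) = 2 ^ length bs"
  by (induction bs rule: increment.induct) (auto simp: trailing_ones_def)

lemma length_alternate: "length (alternate c xs) = (length xs + of_bool c) div 2"
  by (induction c xs rule: alternate.induct) auto

lemma set_alternate: "set (alternate c xs) \<subseteq> set xs"
  by (induction c xs rule: alternate.induct) auto

lemma map_alternate: "map f (alternate c xs) = alternate c (map f xs)"
  by (induction c xs rule: alternate.induct) auto

section \<open>Counting the items that do not exceed a fixed element\<close>

definition count_le :: "'a::linorder \<Rightarrow> 'a list \<Rightarrow> nat" where
  "count_le y xs = length (filter (\<lambda>x. x \<le> y) xs)"

lemma count_le_simps [simp]:
  "count_le y [] = 0"
  "count_le y (x # xs) = (if x \<le> y then Suc (count_le y xs) else count_le y xs)"
  "count_le y (xs @ zs) = count_le y xs + count_le y zs"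
  by (auto simp: count_le_def)

lemma count_le_sort [simp]: "count_le y (sort xs) = count_le y xs"
proof -
  have "mset (filter (\<lambda>x. x \<le> y) (sort xs)) = mset (filter (\<lambda>x. x \<le> y) xs)" by simp
  then show ?thesis unfolding count_le_def by (metis size_mset)
qed

lemma count_le_eq_0: "(\<And>x. x \<in> set xs \<Longrightarrow> \<not> x \<le> y) \<Longrightarrow> count_le y xs = 0"
  by (simp add: count_le_def)

lemma count_le_take: "sorted xs \<Longrightarrow> count_le y (take n xs) = min n (count_le y xs)"
proof (induction xs arbitrary: n)
  case (Cons x xs)
  show ?case
  proof (cases "x \<le> y")
    case True
    then show ?thesis using Cons by (cases n) auto
  next
    case False
    then have "\<And>z. z \<in> set (x # xs) \<Longrightarrow> \<not> z \<le> y" using Cons.prems by auto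
    then have "count_le y (x # xs) = 0" "count_le y (take n (x # xs)) = 0"
      by (auto intro!: count_le_eq_0 dest: in_set_takeD)
    then show ?thesis by simp
  qed
qed simp

lemma count_le_drop: "sorted xs \<Longrightarrow> count_le y (drop n xs) = count_le y xs - n"
  using count_le_take[of xs y n] count_le_simps(3)[of y "take n xs" "drop n xs"]
  by (simp add: min_def split: if_splits)

text \<open>In a sorted list the items not exceeding y form a prefix, so the coin c matters only
  when their number is odd.\<close>

lemma count_le_alternate:
  "sorted xs \<Longrightarrow> count_le y (alternate c xs) = (count_le y xs + of_bool c) div 2"
proof (induction c xs rule: alternate.induct)
  case (2 x xs)
  show ?case
  proof (cases "x \<le> y")
    case True
    then show ?thesis using 2 by simp
  next
    case False
    then have "count_le y xs = 0" using "2.prems" by (auto intro!: count_le_eq_0)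
    then show ?thesis using 2 False by simp
  qed
next
  case (3 x xs)
  show ?case
  proof (cases "x \<le> y")
    case True
    then show ?thesis using 3 by simp
  next
    case False
    then have "count_le y xs = 0" using "3.prems" by (auto intro!: count_le_eq_0)
    then show ?thesis using 3 False by simp
  qed
qed simp

lemma stream_rank_eq_count_le: "stream_rank xs y = count_le y xs"
  by (simp add: stream_rank_def count_le_def length_filter_conv_card)

section \<open>Charging compactions\<close>

text \<open>
  With \<open>\<alpha>\<close> the number of complete blocks of k items not exceeding y in a buffer,
  \<open>pending \<alpha> bs\<close> is the largest number of past compactions affecting y that have
  not yet been paid for by items leaving the level. Bit j of the counter was set by a compaction
  that kept \<open>2 s + 1 - j\<close> blocks, where s is the length of the counter; it can be
  outstanding only while that many blocks are present. The summand \<open>min s \<alpha>\<close> accounts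
  for the compactions at which the counter grew.
\<close>

fun marks :: "nat \<Rightarrow> nat \<Rightarrow> bool list \<Rightarrow> nat" where
  "marks \<alpha> t [] = 0"
| "marks \<alpha> t (b # bs) = of_bool (b \<and> t \<le> \<alpha>) + marks \<alpha> (t - 1) bs"

definition pending :: "nat \<Rightarrow> bool list \<Rightarrow> nat" where
  "pending \<alpha> bs = min (length bs) \<alpha> + marks \<alpha> (2 * length bs + 1) bs"

lemma marks_mono: "\<alpha> \<le> \<beta> \<Longrightarrow> marks \<alpha> t bs \<le> marks \<beta> t bs"
  by (induction bs arbitrary: t) (auto intro: le_SucI)

lemma marks_saturated: "t \<le> \<alpha> \<Longrightarrow> t \<le> \<beta> \<Longrightarrow> marks \<alpha> t bs = marks \<beta> t bs"
  by (induction bs arbitrary: t) auto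

lemma marks_le_length: "marks \<alpha> t bs \<le> length bs"
proof (induction bs arbitrary: t)
  case (Cons b bs)
  have "marks \<alpha> (t - 1) bs \<le> length bs" by (rule Cons)
  then show ?case by (simp add: of_bool_def)
qed simp

text \<open>The bits have the distinct thresholds \<open>t\<close>, \<open>t - 1\<close>, and so on,
  all larger than \<open>t - length bs\<close>; at most \<open>\<alpha> - (t - length bs)\<close> of
  them can be at most \<alpha>.\<close>

lemma marks_le: "length bs \<le> t \<Longrightarrow> marks \<alpha> t bs \<le> \<alpha> - (t - length bs)"
proof (induction bs arbitrary: t)
  case (Cons b bs)
  then have "marks \<alpha> (t - 1) bs \<le> \<alpha> - (t - 1 - length bs)" by (intro Cons.IH) simp
  with marks_le_length[of \<alpha> "t - 1" bs] show ?case using Cons.prems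
    by (auto simp: of_bool_def)
qed simp

text \<open>A block answers for at most one compaction: marks count only from
  \<open>length bs + 2\<close> blocks on, where the summand \<open>min (length bs) \<alpha>\<close>
  has already stopped growing.\<close>

lemma pending_le: "pending \<alpha> bs \<le> \<alpha>"
  using marks_le[of bs "2 * length bs + 1" \<alpha>] by (auto simp: pending_def)

lemma pending_mono: "\<alpha> \<le> \<beta> \<Longrightarrow> pending \<alpha> bs \<le> pending \<beta> bs"
  using marks_mono[of \<alpha> \<beta>] by (auto simp: pending_def intro!: add_mono)

text \<open>The bits cleared by the carry have thresholds above \<open>t - trailing_ones bs\<close>,
  hence above \<alpha>, so no counted mark is lost.\<close>

lemma marks_increment_ge:
  "\<alpha> \<le> t - trailing_ones bs \<Longrightarrow> length bs < t \<Longrightarrow> marks \<alpha> t bs \<le> marks \<alpha> t (increment bs)"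
proof (induction bs arbitrary: t rule: increment.induct)
  case (3 bs)
  have "\<alpha> < t" using 3 by (auto simp: trailing_ones_def)
  then show ?case using 3 by (auto simp: trailing_ones_def)
qed (auto simp: trailing_ones_def)

text \<open>Serves compactions that do not reach y: no claim may vanish, because no item leaves that
  could pay for it.\<close>

lemma pending_increment_ge:
  assumes "\<alpha> \<le> kept bs"
  shows "pending \<alpha> bs \<le> pending \<alpha> (increment bs)"
proof (cases "length (increment bs) = length bs")
  case True
  then show ?thesis
    using marks_increment_ge[of \<alpha> "2 * length bs + 1" bs] assms by (simp add: pending_def kept_def)
next
  case False
  then have z: "trailing_ones bs = length bs" "length (increment bs) = Suc (length bs)"
    using length_increment[of bs] by auto
  \<comment> \<open>All thresholds are at least \<open>length bs + 2\<close>, while here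
    \<open>kept bs = length bs + 1\<close>.\<close>
  then have "marks \<alpha> (2 * length bs + 1) bs = 0"
    using marks_le[of bs "2 * length bs + 1" \<alpha>] assms by (simp add: kept_def)
  then show ?thesis by (simp add: pending_def z)
qed

text \<open>The newly set bit has threshold \<open>t - trailing_ones bs\<close> and counts as one
  mark. Cleared bits that were counted have distinct thresholds above it and at most \<alpha>, so
  the difference on the right covers them. Higher bits count before and after.\<close>

lemma marks_increment:
  "length (increment bs) = length bs \<Longrightarrow> length bs < t \<Longrightarrow> t - trailing_ones bs \<le> \<alpha> \<Longrightarrow>
   marks \<alpha> t bs + 1 \<le> marks (t - trailing_ones bs) t (increment bs) + (\<alpha> - (t - trailing_ones bs))"
proof (induction bs arbitrary: t \<alpha> rule: increment.induct)
  case (2 bs)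
  then show ?case using marks_saturated[of "t - 1" \<alpha> t bs] by (simp add: trailing_ones_def)
next
  case (3 bs)
  define z where "z = trailing_ones bs"
  have [simp]: "trailing_ones (True # bs) = Suc z" by (simp add: z_def trailing_ones_def)
  have IH: "t - 1 - z \<le> \<beta> \<Longrightarrow>
     marks \<beta> (t - 1) bs + 1 \<le> marks (t - 1 - z) (t - 1) (increment bs) + (\<beta> - (t - 1 - z))" for \<beta>
    unfolding z_def using 3 by (intro "3.IH") (auto simp: trailing_ones_def)
  show ?case
  proof (cases "t \<le> \<alpha>")
    case True
    \<comment> \<open>The first bit is counted as well. The induction hypothesis at
      \<open>t - 1\<close> handles the others and leaves one block over to pay for it.\<close>
    then have "marks \<alpha> (t - 1) bs = marks (t - 1) (t - 1) bs" by (intro marks_saturated) auto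
    moreover have "t - 1 - (t - 1 - z) = z"
      using "3.prems" trailing_ones_le[of bs] by (simp add: z_def)
    then have "marks (t - 1) (t - 1) bs + 1 \<le> marks (t - 1 - z) (t - 1) (increment bs) + z"
      using IH[OF diff_le_self] by simp
    moreover have "z + 1 \<le> \<alpha> - (t - Suc z)"
      using True "3.prems" trailing_ones_le[of bs] by (simp add: z_def)
    ultimately show ?thesis using True by simp
  next
    case False
    then show ?thesis using IH[of \<alpha>] "3.prems" by auto
  qed
qed auto

text \<open>This finances a compaction that reaches y: the \<open>\<alpha> - kept bs\<close> blocks
  that leave settle the vanishing claims, and a new claim arises for the compaction itself. When the
  counter grows, the summand \<open>min\<close> in \<open>pending\<close> provides that
  claim.\<close>

lemma pending_increment:
  assumes "kept bs \<le> \<alpha>"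
  shows "pending \<alpha> bs + 1 \<le> pending (kept bs) (increment bs) + (\<alpha> - kept bs)"
proof (cases "length (increment bs) = length bs")
  case True
  then show ?thesis
    using marks_increment[of bs "2 * length bs + 1" \<alpha>] assms kept_ge[of bs]
    by (simp add: pending_def kept_def)
next
  case False
  then have z: "trailing_ones bs = length bs" "length (increment bs) = Suc (length bs)"
    using length_increment[of bs] by auto
  then have "kept bs = length bs + 1" by (simp add: kept_def)
  then show ?thesis
    using marks_le[of bs "2 * length bs + 1" \<alpha>] assms z
    by (simp add: pending_def)
qed

section \<open>The supermartingale\<close>

text \<open>Hoeffding's lemma gives the exponent \<open>X^2 / 2\<close>, the size of x alone gives
  \<open>X\<close>. For \<open>X = 2 * lam * 2 ^ g\<close> with \<open>g < H\<close> the combined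
  exponent is \<open>k * charge g\<close>.\<close>

lemma cosh_le_exp:
  fixes x X :: real
  assumes "\<bar>x\<bar> \<le> X"
  shows "(exp x + exp (- x)) / 2 \<le> exp (X * min 1 (X / 2))"
proof -
  have sub: "(exp u + exp (- u)) / 2 \<le> exp (u\<^sup>2 / 2)" if "0 \<le> u" for u :: real
  proof -
    \<comment> \<open>A fair 0-1 variable, centred and scaled by \<open>2 * u\<close>, is a fair
      sign times u.\<close>
    have "- (2 * u) * (1 / 2) + ln (1 + 1 / 2 * (exp (2 * u) - 1)) \<le> (2 * u)\<^sup>2 / 8"
      using Hoeffdings_lemma_aux[of "2 * u" "1 / 2"] that by simp
    then have "ln ((1 + exp (2 * u)) / 2) \<le> u + u\<^sup>2 / 2"
      by (simp add: power2_eq_square field_simps)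
    then have "exp (ln ((1 + exp (2 * u)) / 2)) \<le> exp (u + u\<^sup>2 / 2)" by simp
    then have "(1 + exp u * exp u) / 2 \<le> exp u * exp (u\<^sup>2 / 2)"
      by (simp add: exp_add add_pos_pos exp_double power2_eq_square)
    then show ?thesis by (simp add: exp_minus field_simps)
  qed
  have "(exp x + exp (- x)) / 2 \<le> exp (x\<^sup>2 / 2)"
    using sub[of x] sub[of "- x"] by (cases "0 \<le> x") (auto simp: add.commute)
  also have "x\<^sup>2 \<le> X\<^sup>2" using assms by (simp add: abs_le_square_iff[symmetric])
  finally have 1: "(exp x + exp (- x)) / 2 \<le> exp (X * (X / 2))" by (simp add: power2_eq_square)
  have "exp x \<le> exp X" "exp (- x) \<le> exp X" using assms by auto
  then have 2: "(exp x + exp (- x)) / 2 \<le> exp (X * 1)" by (simp del: exp_le_cancel_iff)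
  show ?thesis using 1 2 by (cases "1 \<le> X / 2") (auto simp: min_def)
qed

text \<open>The last assumption is \<open>drift 0 <= lam\<close>. It keeps
  \<open>\<sigma> * lam + drift g\<close> within \<open>2 * lam\<close> in absolute value for both
  signs \<sigma>, which explains the factor \<open>2 * lam\<close> in \<open>charge\<close>.\<close>

locale potential =
  fixes y :: "'a::linorder" and k H :: nat and lam :: real
  assumes k_pos: "0 < k" and lam_nonneg: "0 \<le> lam"
    and drift_le: "2 * lam / k * (\<Sum>i<H. min 1 (lam * 2 ^ i)) \<le> lam"
begin

text \<open>
  \<open>charge g\<close> is the deposit per item on level g, so that k items pay for one compaction;
  from H on, compactions are free. \<open>drift\<close> is the resulting distortion of the parameter
  \<open>\<sigma> * lam\<close>, where \<open>\<sigma> = 1\<close> serves the upper and \<open>\<sigma> = - 1\<close> the lower tail.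
\<close>

definition charge :: "nat \<Rightarrow> real" where
  "charge g = (if g < H then 2 ^ g * (2 * lam / k) * min 1 (lam * 2 ^ g) else 0)"

definition drift :: "nat \<Rightarrow> real" where
  "drift g = (\<Sum>i=g..<H. charge i / 2 ^ i)"

text \<open>Of the amount \<open>drift g * 2 ^ g\<close> per item, \<open>charge g\<close> is the
  deposit for this level and the rest serves the levels above. Deposits already spent on pending
  compactions are subtracted.\<close>

definition level_pot :: "real \<Rightarrow> nat \<Rightarrow> bool list \<Rightarrow> nat \<Rightarrow> real" where
  "level_pot \<sigma> g bs a =
     (\<sigma> * lam + drift g) * 2 ^ g * a - k * charge g * pending (a div k) bs"

fun pot :: "real \<Rightarrow> nat \<Rightarrow> 'a level list \<Rightarrow> real" where
  "pot \<sigma> g [] = 0"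
| "pot \<sigma> g ((bs, b) # ls) = level_pot \<sigma> g bs (count_le y b) + pot \<sigma> (Suc g) ls"

text \<open>The weights \<open>u\<close> and \<open>v\<close> absorb factors that are already fixed:
  the thresholds of the tail event, the levels below g and the items still to arrive.\<close>

definition Phi :: "nat \<Rightarrow> real \<Rightarrow> real \<Rightarrow> 'a level list \<Rightarrow> real" where
  "Phi g u v ls = min 1 (u * exp (pot 1 g ls) + v * exp (pot (- 1) g ls))"

lemma charge_nonneg: "0 \<le> charge g"
  using lam_nonneg by (simp add: charge_def)

lemma drift_step: "drift g = drift (Suc g) + charge g / 2 ^ g"
  by (cases "g < H") (auto simp: drift_def sum.atLeast_Suc_lessThan charge_def)

lemma drift_nonneg: "0 \<le> drift g"
  by (auto simp: drift_def intro!: sum_nonneg divide_nonneg_pos charge_nonneg)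

lemma drift_0: "drift 0 = 2 * lam / k * (\<Sum>i<H. min 1 (lam * 2 ^ i))"
  by (auto simp: drift_def charge_def sum_distrib_left atLeast0LessThan intro!: sum.cong)

lemma drift_le_lam: "drift g \<le> lam"
proof -
  have "drift g \<le> drift 0"
    by (auto simp: drift_def intro!: sum_mono2 divide_nonneg_pos charge_nonneg)
  with drift_le show ?thesis by (simp add: drift_0)
qed

text \<open>By \<open>pending_le\<close>, no more than the deposits of the items present has been
  spent; giving up what remains of them turns \<open>drift g\<close> into
  \<open>drift (Suc g)\<close>.\<close>

lemma level_pot_ge:
  "(\<sigma> * lam + drift (Suc g)) * 2 ^ g * a \<le> level_pot \<sigma> g bs a"
proof -
  have "k * pending (a div k) bs \<le> k * (a div k)" by (simp add: pending_le)
  also have "\<dots> \<le> a" by simp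
  finally have "real k * pending (a div k) bs \<le> a"
    by (metis of_nat_le_iff of_nat_mult)
  then have "charge g * (real k * pending (a div k) bs) \<le> charge g * a"
    using charge_nonneg by (rule mult_left_mono)
  then show ?thesis unfolding level_pot_def by (subst drift_step) (simp add: field_simps)
qed

lemma level_pot_nonneg: "0 \<le> level_pot 1 g bs a"
  using level_pot_ge[of 1 g a bs] lam_nonneg drift_nonneg[of "Suc g"]
  by (smt (verit) mult_nonneg_nonneg of_nat_0_le_iff zero_le_power)

lemma pot_nonneg: "0 \<le> pot 1 g ls"
  by (induction ls arbitrary: g) (auto intro!: add_nonneg_nonneg level_pot_nonneg)

lemma level_pot_add:
  "level_pot \<sigma> g bs (a + c) \<le> level_pot \<sigma> g bs a + (\<sigma> * lam + drift g) * 2 ^ g * c"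
proof -
  have "pending (a div k) bs \<le> pending ((a + c) div k) bs"
    by (intro pending_mono div_le_mono) simp
  then have "k * charge g * pending (a div k) bs \<le> k * charge g * pending ((a + c) div k) bs"
    using charge_nonneg by (intro mult_left_mono) auto
  then show ?thesis by (simp add: level_pot_def algebra_simps)
qed

lemma level_pot_increment:
  assumes "a \<le> k * kept bs"
  shows "level_pot \<sigma> g (increment bs) a \<le> level_pot \<sigma> g bs a"
proof -
  have "a div k \<le> kept bs" using div_le_mono[OF assms, of k] k_pos by simp
  then have "pending (a div k) bs \<le> pending (a div k) (increment bs)"
    by (rule pending_increment_ge)
  then show ?thesis
    using charge_nonneg k_pos by (auto simp: level_pot_def intro!: mult_left_mono)
qed

text \<open>Here \<open>K\<close> items stay and r items not exceeding y leave. For even r the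
  promoted weight is exact; for odd r it errs by \<open>2 ^ g\<close> in either direction with equal
  probability, and the resulting factor \<open>(exp x + exp (- x)) / 2\<close> is paid by the amount
  \<open>k * charge g\<close> that \<open>pending_increment\<close> releases.\<close>

lemma level_pot_compact:
  fixes bs :: "bool list"
  assumes g: "g < H" and \<sigma>: "\<bar>\<sigma>\<bar> = 1"
  defines "K \<equiv> k * kept bs" and "\<beta> \<equiv> \<sigma> * lam + drift (Suc g)"
  shows "(exp (level_pot \<sigma> g (increment bs) K + \<beta> * 2 ^ Suc g * real ((r + 1) div 2))
        + exp (level_pot \<sigma> g (increment bs) K + \<beta> * 2 ^ Suc g * real (r div 2))) / 2
        \<le> exp (level_pot \<sigma> g bs (K + r))"
proof -
  define x where "x = \<beta> * 2 ^ g"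
  define P where "P = level_pot \<sigma> g (increment bs) K"
  define q where "q = charge g"
  have q: "0 \<le> q" "k * q = (2 * lam * 2 ^ g) * min 1 (lam * 2 ^ g)"
    using charge_nonneg[of g] g k_pos by (auto simp: q_def charge_def)
  have kq: "0 \<le> k * q" using q(1) by simp
  \<comment> \<open>\<open>K\<close> is a multiple of k, so rounding down to blocks affects only the
    leaving items.\<close>
  have Kk: "K div k = kept bs" "(K + r) div k = kept bs + r div k"
    using k_pos by (auto simp: K_def)
  have "pending ((K + r) div k) bs + 1 \<le> pending (K div k) (increment bs) + r div k"
    using pending_increment[of bs "kept bs + r div k"] by (simp add: Kk)
  then have "real (pending ((K + r) div k) bs) + 1 \<le> pending (K div k) (increment bs) + real (r div k)"
    by (metis of_nat_1 of_nat_add of_nat_le_iff)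
  also have "real (r div k) \<le> r / k" by (rule of_nat_div_le_of_nat)
  finally have "k * q * (real (pending ((K + r) div k) bs) + 1)
    \<le> k * q * (pending (K div k) (increment bs) + r / k)"
    by (intro mult_left_mono kq) simp
  moreover have "drift g * 2 ^ g = drift (Suc g) * 2 ^ g + q"
    unfolding q_def by (subst drift_step) (simp add: field_simps)
  ultimately have main: "P + x * r + k * q \<le> level_pot \<sigma> g bs (K + r)"
    using k_pos by (simp add: P_def level_pot_def x_def \<beta>_def q_def[symmetric] algebra_simps)
  have "\<bar>\<beta>\<bar> \<le> 2 * lam"
    using \<sigma> drift_nonneg[of "Suc g"] drift_le_lam[of "Suc g"] by (auto simp: \<beta>_def abs_if split: if_splits)
  then have "\<bar>x\<bar> \<le> 2 * lam * 2 ^ g" by (simp add: x_def abs_mult)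
  then have ch: "(exp x + exp (- x)) / 2 \<le> exp (k * q)"
    using cosh_le_exp[of x "2 * lam * 2 ^ g"] by (simp add: q)
  have "(exp (P + x * (2 * real ((r + 1) div 2))) + exp (P + x * (2 * real (r div 2)))) / 2
      \<le> exp (P + x * r + k * q)"
  proof (cases "even r")
    case True
    then obtain m where r: "r = 2 * m" by auto
    show ?thesis using kq by (simp add: r)
  next
    case False
    then obtain m where r: "r = 2 * m + 1" by (auto elim: oddE)
    have "(exp (P + x * (2 * real ((r + 1) div 2))) + exp (P + x * (2 * real (r div 2)))) / 2
      = exp (P + x * r) * ((exp x + exp (- x)) / 2)"
      by (simp add: r algebra_simps flip: exp_add)
    also have "\<dots> \<le> exp (P + x * r) * exp (k * q)"
      using ch by (intro mult_left_mono) auto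
    finally show ?thesis by (simp add: exp_add)
  qed
  also have "\<dots> \<le> exp (level_pot \<sigma> g bs (K + r))" using main by simp
  finally show ?thesis by (simp add: P_def x_def mult_ac)
qed

end

section \<open>Expected potential while the stream is processed\<close>

lemma finite_set_pmf_feed [simp]: "finite (set_pmf (feed srt k xs ls))"
  by (induction srt k xs ls rule: feed.induct) auto

lemma finite_set_pmf_run [simp]: "finite (set_pmf (run k xs ls))"
  by (induction xs arbitrary: ls) auto

lemma expectation_fair_coin_bind:
  fixes f :: "'b \<Rightarrow> real"
  assumes "\<And>c. finite (set_pmf (p c))"
  shows "measure_pmf.expectation (bind_pmf (bernoulli_pmf (1/2)) p) f
    = (measure_pmf.expectation (p True) f + measure_pmf.expectation (p False) f) / 2"
  using assms by (subst pmf_expectation_bind[of UNIV]) (auto simp: UNIV_bool)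

fun estimate :: "'a::linorder \<Rightarrow> nat \<Rightarrow> 'a level list \<Rightarrow> real" where
  "estimate y g [] = 0"
| "estimate y g ((bs, b) # ls) = 2 ^ g * count_le y b + estimate y (Suc g) ls"

context potential
begin

text \<open>The combination without its cut-off, with c further items not exceeding y counted on
  level g before any compaction.\<close>

definition Phi_bound :: "nat \<Rightarrow> real \<Rightarrow> real \<Rightarrow> nat \<Rightarrow> 'a level list \<Rightarrow> real" where
  "Phi_bound g u v c ls =
     u * exp ((lam + drift g) * 2 ^ g * c + pot 1 g ls)
     + v * exp ((- lam + drift g) * 2 ^ g * c + pot (- 1) g ls)"

lemma Phi_Cons:
  "Phi g u v ((bs, b) # ls) =
   Phi (Suc g) (u * exp (level_pot 1 g bs (count_le y b)))
     (v * exp (level_pot (- 1) g bs (count_le y b))) ls"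
  by (simp add: Phi_def exp_add mult_ac)

lemma expectation_Phi_le_1: "0 \<le> u \<Longrightarrow> 0 \<le> v \<Longrightarrow> finite (set_pmf p) \<Longrightarrow> measure_pmf.expectation p (Phi g u v) \<le> 1"
  by (rule measure_pmf.integral_le_const) (auto simp: Phi_def intro: integrable_measure_pmf_finite)

text \<open>Induction over the levels with \<open>u\<close> and \<open>v\<close> arbitrary, since
  the factor of a finished level moves into them. By the last hypothesis, k items not exceeding y on
  a level from \<open>H\<close> on already make the first term at least 1, so only levels below
  \<open>H\<close> have to pay.\<close>

lemma expectation_feed_le:
  assumes "0 \<le> u" "0 \<le> v" "1 \<le> u * exp (lam * 2 ^ H * k)"
  shows "measure_pmf.expectation (feed sort k xs ls) (Phi g u v)
    \<le> Phi_bound g u v (count_le y xs) ls"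
  using assms
proof (induction ls arbitrary: g u v xs)
  case Nil
  have "level_pot \<sigma> g [] a = (\<sigma> * lam + drift g) * 2 ^ g * a" for \<sigma> a
    by (simp add: level_pot_def pending_def)
  then show ?case by (simp add: Phi_def Phi_bound_def min_def)
next
  case (Cons l ls)
  obtain bs b where l: "l = (bs, b)" by (cases l)
  define K where "K = k * kept bs"
  define a where "a = count_le y (b @ xs)"
  define L where "L = (\<lambda>\<sigma>. exp (level_pot \<sigma> g bs a))"
  define L' where "L' = (\<lambda>\<sigma>. exp (level_pot \<sigma> g (increment bs) (min K a)))"
  define B where "B = u * L 1 * exp (pot 1 (Suc g) ls) + v * L (- 1) * exp (pot (- 1) (Suc g) ls)"
  have a: "a = count_le y b + count_le y xs" by (simp add: a_def)
  have "level_pot \<sigma> g bs a + pot \<sigma> (Suc g) ls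
      \<le> (\<sigma> * lam + drift g) * 2 ^ g * count_le y xs + pot \<sigma> g (l # ls)" for \<sigma>
    using level_pot_add[of \<sigma> g bs "count_le y b" "count_le y xs"] by (simp add: l a)
  then have "L \<sigma> * exp (pot \<sigma> (Suc g) ls)
      \<le> exp ((\<sigma> * lam + drift g) * 2 ^ g * count_le y xs + pot \<sigma> g (l # ls))" for \<sigma>
    by (simp add: L_def flip: exp_add)
  from this[of 1] this[of "- 1"] have B_le: "B \<le> Phi_bound g u v (count_le y xs) (l # ls)"
    using Cons.prems by (auto simp: B_def Phi_bound_def mult.assoc intro!: add_mono mult_left_mono)
  show ?case
  proof (cases "length (b @ xs) < k * (2 * length bs + 2)")
    case True
    have "measure_pmf.expectation (feed sort k xs (l # ls)) (Phi g u v) \<le> B"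
      using True by (simp add: l Phi_def B_def L_def a exp_add mult.assoc min_def)
    with B_le show ?thesis by simp
  next
    case False
    define E where "E = (\<lambda>c. measure_pmf.expectation
      (feed sort k (alternate c (drop K (sort (b @ xs)))) ls) (Phi (Suc g) (u * L' 1) (v * L' (- 1))))"
    define r where "r = (\<lambda>c. (a - K + of_bool c) div 2)"
    have fin: "finite (set_pmf (feed sort k xs ls))" for xs :: "'a list" by simp
    have "min K a = count_le y (take K (sort (b @ xs)))"
      by (simp only: count_le_take[OF sorted_sort] count_le_sort a_def)
    then have "(\<lambda>ls'. Phi g u v ((increment bs, take K (sort (b @ xs))) # ls'))
      = Phi (Suc g) (u * L' 1) (v * L' (- 1))"
      by (auto simp: Phi_Cons L'_def)
    then have E: "measure_pmf.expectation (feed sort k xs (l # ls)) (Phi g u v) = (E True + E False) / 2"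
      using False by (simp add: l expectation_fair_coin_bind fin E_def K_def[symmetric])
    \<comment> \<open>For the upper tail the factor of this level is at least 1, so the hypothesis
      on u survives the passage to the next level.\<close>
    have "1 \<le> L' 1" using level_pot_nonneg by (simp add: L'_def)
    then have "u * exp (lam * 2 ^ H * k) * 1 \<le> u * exp (lam * 2 ^ H * k) * L' 1"
      using Cons.prems by (intro mult_left_mono) auto
    then have pre: "0 \<le> u * L' 1" "0 \<le> v * L' (- 1)" "1 \<le> u * L' 1 * exp (lam * 2 ^ H * k)"
      using Cons.prems by (auto simp: L'_def mult_ac)
    have "count_le y (alternate c (drop K (sort (b @ xs)))) = r c" for c
      by (subst count_le_alternate) (simp_all only: sorted_wrt_drop sorted_sort count_le_drop count_le_sort r_def a_def)
    then have E_le: "E c \<le> Phi_bound (Suc g) (u * L' 1) (v * L' (- 1)) (r c) ls" for c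
      using Cons.IH[OF pre, of "alternate c (drop K (sort (b @ xs)))" "Suc g"] by (simp add: E_def)
    have E_le_1: "E c \<le> 1" for c
      unfolding E_def using pre fin by (intro expectation_Phi_le_1)
    consider "a \<le> K" | "K < a" "g < H" | "K < a" "H \<le> g" by linarith
    then have "(E True + E False) / 2 \<le> B"
    proof cases
      \<comment> \<open>All items not exceeding y stay, so for either outcome of the coin only the
        new counter affects the potential.\<close>
      case 1
      then have r: "r c = 0" for c by (simp add: r_def)
      have "L' \<sigma> \<le> L \<sigma>" for \<sigma>
        using level_pot_increment[of a bs \<sigma> g] 1 by (simp add: L'_def L_def K_def)
      then have "E c \<le> B" for c
        using E_le[of c] Cons.prems
        by (elim order_trans) (auto simp: Phi_bound_def r B_def intro!: add_mono mult_right_mono mult_left_mono)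
      from this[of True] this[of False] show ?thesis by simp
    next
      \<comment> \<open>The coin matters here: for each sign, the average over both outcomes is
        bounded by \<open>level_pot_compact\<close>.\<close>
      case 2
      define D where "D = (\<lambda>\<sigma> c. L' \<sigma> * exp ((\<sigma> * lam + drift (Suc g)) * 2 ^ Suc g * r c))"
      have r: "r True = (a - K + 1) div 2" "r False = (a - K) div 2" by (auto simp: r_def)
      have "(D \<sigma> True + D \<sigma> False) / 2 \<le> L \<sigma>" if "\<bar>\<sigma>\<bar> = 1" for \<sigma>
        using level_pot_compact[OF 2(2) that, of bs "a - K"] 2(1)
        by (simp only: D_def L'_def L_def r K_def[symmetric] exp_add[symmetric])
          (simp add: min_def)
      from this[of 1] this[of "- 1"]
      have "u * ((D 1 True + D 1 False) / 2) * exp (pot 1 (Suc g) ls)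
          + v * ((D (- 1) True + D (- 1) False) / 2) * exp (pot (- 1) (Suc g) ls) \<le> B"
        unfolding B_def using Cons.prems by (intro add_mono mult_right_mono mult_left_mono) auto
      moreover have "E c \<le> u * D 1 c * exp (pot 1 (Suc g) ls) + v * D (- 1) c * exp (pot (- 1) (Suc g) ls)" for c
        using E_le[of c] by (simp add: Phi_bound_def D_def exp_add mult_ac)
      from this[of True] this[of False] calculation show ?thesis
        by (simp add: algebra_simps add_divide_distrib)
    next
      \<comment> \<open>The overflowing buffer holds at least k items not exceeding y on a level
        from \<open>H\<close> on, so \<open>B\<close> is at least 1 and the cut-off settles the
        claim.\<close>
      case 3
      have "k * 1 \<le> K" unfolding K_def using kept_ge[of bs] by (intro mult_left_mono) auto
      then have ka: "real k \<le> real a" using 3 by simp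
      have Hg: "(2 :: real) ^ H \<le> 2 ^ g" using 3 by simp
      have "2 ^ H * real k \<le> 2 ^ g * real a" using mult_mono[OF Hg ka] by simp
      then have "lam * (2 ^ H * k) \<le> lam * (2 ^ g * a)"
        using lam_nonneg by (intro mult_left_mono) auto
      also have "\<dots> \<le> (lam + drift (Suc g)) * (2 ^ g * a)"
        using drift_nonneg by (intro mult_right_mono) auto
      also have "\<dots> \<le> level_pot 1 g bs a" using level_pot_ge[of 1 g a bs] by (simp add: mult_ac)
      finally have "exp (lam * 2 ^ H * k) \<le> L 1 * exp (pot 1 (Suc g) ls)"
        using pot_nonneg[of "Suc g" ls] by (simp add: L_def mult_ac flip: exp_add)
      then have "u * exp (lam * 2 ^ H * k) \<le> u * (L 1 * exp (pot 1 (Suc g) ls))"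
        using Cons.prems by (intro mult_left_mono)
      moreover have "0 \<le> v * L (- 1) * exp (pot (- 1) (Suc g) ls)" using Cons.prems by (simp add: L_def)
      ultimately have "1 \<le> B" using Cons.prems by (simp add: B_def mult.assoc)
      then show ?thesis using E_le_1[of True] E_le_1[of False] by simp
    qed
    with B_le E show ?thesis by simp
  qed
qed

lemma expectation_run_le:
  assumes "0 \<le> u" "0 \<le> v" "1 \<le> u * exp (lam * 2 ^ H * k)"
  shows "measure_pmf.expectation (run k xs ls) (Phi 0 u v) \<le> Phi_bound 0 u v (count_le y xs) ls"
  using assms
proof (induction xs arbitrary: ls)
  case Nil
  show ?case by (simp add: Phi_def Phi_bound_def min_def)
next
  case (Cons x xs)
  \<comment> \<open>The factor of the items still to come, to be moved into \<open>u\<close> and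
    \<open>v\<close>.\<close>
  define c where "c = (\<lambda>\<sigma>. exp ((\<sigma> * lam + drift 0) * count_le y xs))"
  have c: "1 \<le> c 1" "0 \<le> c \<sigma>" for \<sigma>
    using lam_nonneg drift_nonneg by (auto simp: c_def)
  have "u * exp (lam * 2 ^ H * k) * 1 \<le> u * exp (lam * 2 ^ H * k) * c 1"
    using Cons.prems c by (intro mult_left_mono) auto
  then have pre: "0 \<le> u * c 1" "0 \<le> v * c (- 1)" "1 \<le> u * c 1 * exp (lam * 2 ^ H * k)"
    using Cons.prems c by (auto simp: mult_ac)
  let ?F = "feed sort k [x] ls"
  have "measure_pmf.expectation (run k xs ls') (Phi 0 u v) \<le> Phi 0 (u * c 1) (v * c (- 1)) ls'" for ls'
  proof -
    have "measure_pmf.expectation (run k xs ls') (Phi 0 u v) \<le> 1"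
      using Cons.prems by (intro expectation_Phi_le_1) auto
    \<comment> \<open>An expectation that is at most 1 and at most \<open>Phi_bound\<close> is at
      most their minimum; this restores the cut-off that \<open>expectation_feed_le\<close> works
      with.\<close>
    moreover have "Phi 0 (u * c 1) (v * c (- 1)) ls' = min 1 (Phi_bound 0 u v (count_le y xs) ls')"
      by (simp add: Phi_def Phi_bound_def c_def exp_add mult_ac)
    ultimately show ?thesis using Cons.IH[OF Cons.prems, of ls'] by simp
  qed
  then have "(\<Sum>ls'\<in>set_pmf ?F. pmf ?F ls' * measure_pmf.expectation (run k xs ls') (Phi 0 u v))
      \<le> (\<Sum>ls'\<in>set_pmf ?F. pmf ?F ls' * Phi 0 (u * c 1) (v * c (- 1)) ls')"
    by (intro sum_mono mult_left_mono) auto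
  also have "\<dots> = measure_pmf.expectation ?F (Phi 0 (u * c 1) (v * c (- 1)))"
    by (subst integral_measure_pmf[of "set_pmf ?F"]) (auto simp: mult_ac)
  also have "\<dots> \<le> Phi_bound 0 (u * c 1) (v * c (- 1)) (count_le y [x]) ls"
    by (rule expectation_feed_le[OF pre])
  also have "\<dots> = Phi_bound 0 u v (count_le y (x # xs)) ls"
    by (simp add: Phi_bound_def c_def exp_add[symmetric] mult.assoc algebra_simps)
  finally show ?case
    by (simp add: pmf_expectation_bind[of "set_pmf ?F"])
qed

lemma pot_ge_estimate: "\<sigma> * lam * estimate y g ls \<le> pot \<sigma> g ls"
proof (induction ls arbitrary: g)
  case (Cons l ls)
  obtain bs b where l: "l = (bs, b)" by (cases l)
  have "\<sigma> * lam * (2 ^ g * count_le y b) \<le> (\<sigma> * lam + drift (Suc g)) * (2 ^ g * count_le y b)"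
    using drift_nonneg by (intro mult_right_mono) auto
  also have "\<dots> \<le> level_pot \<sigma> g bs (count_le y b)" using level_pot_ge[of \<sigma> g _ bs] by (simp add: mult.assoc)
  finally show ?case using Cons.IH[of "Suc g"] by (simp add: l algebra_simps)
qed simp

text \<open>Markov's inequality for \<open>Phi\<close>: with these \<open>u\<close> and
  \<open>v\<close>, each half of the bad event forces one exponential term to be at least 1. The
  assumption on \<open>U\<close> yields the condition at level \<open>H\<close>.\<close>

lemma prob_estimate_le:
  fixes U D :: real
  assumes "U \<le> 2 ^ H * k"
  shows "measure_pmf.prob (run k xs []) {ls. estimate y 0 ls \<le> D \<or> U \<le> estimate y 0 ls}
    \<le> exp ((lam + drift 0) * count_le y xs - lam * U) + exp (lam * D - (lam - drift 0) * count_le y xs)"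
proof -
  define u v where "u = exp (- lam * U)" and "v = exp (lam * D)"
  let ?S = "{ls. estimate y 0 ls \<le> D \<or> U \<le> estimate y 0 ls}"
  have "lam * U \<le> lam * (2 ^ H * k)" using assms lam_nonneg by (intro mult_left_mono)
  then have pre: "0 \<le> u" "0 \<le> v" "1 \<le> u * exp (lam * 2 ^ H * k)"
    by (auto simp: u_def v_def mult.assoc simp flip: exp_add)
  have "indicator ?S ls \<le> Phi 0 u v ls" for ls
  proof (cases "ls \<in> ?S")
    case False
    then show ?thesis using pre by (simp add: Phi_def)
  next
    case True
    have "1 \<le> u * exp (pot 1 0 ls)" if "U \<le> estimate y 0 ls"
      using pot_ge_estimate[of 1 0 ls] mult_left_mono[OF that lam_nonneg]
      by (simp add: u_def flip: exp_add)
    moreover have "1 \<le> v * exp (pot (- 1) 0 ls)" if "estimate y 0 ls \<le> D"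
      using pot_ge_estimate[of "- 1" 0 ls] mult_left_mono[OF that lam_nonneg]
      by (simp add: v_def flip: exp_add)
    moreover have "0 \<le> u * exp (pot 1 0 ls)" "0 \<le> v * exp (pot (- 1) 0 ls)" using pre by auto
    ultimately have "1 \<le> Phi 0 u v ls" using True unfolding Phi_def by auto
    then show ?thesis using True by simp
  qed
  then have "measure_pmf.expectation (run k xs []) (indicator ?S) \<le> measure_pmf.expectation (run k xs []) (Phi 0 u v)"
    by (intro integral_mono integrable_measure_pmf_finite) auto
  also have "\<dots> \<le> Phi_bound 0 u v (count_le y xs) []"
    by (rule expectation_run_le[OF pre])
  finally show ?thesis
    by (simp add: Phi_bound_def u_def v_def algebra_simps flip: exp_add)
qed

end

section \<open>The comparison-based algorithm\<close>

text \<open>Apart from sorting, compactors use only positions, so they commute with every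
  relabelling that is compatible with the sorting functions. It is applied to the map that reads a
  memory slot.\<close>

lemma map_pmf_feed:
  assumes "\<And>l. set l \<subseteq> S \<Longrightarrow> map f (srt l) = srt' (map f l)" "\<And>l. set (srt l) = set l"
    "set xs \<subseteq> S" "\<forall>(bs, b) \<in> set ls. set b \<subseteq> S"
  shows "map_pmf (map (map_prod id (map f))) (feed srt k xs ls)
    = feed srt' k (map f xs) (map (map_prod id (map f)) ls)"
  using assms(3,4)
proof (induction ls arbitrary: xs)
  case (Cons l ls)
  obtain bs b where l: "l = (bs, b)" by (cases l)
  have S: "set (b @ xs) \<subseteq> S" using Cons.prems l by auto
  have IH: "map_pmf (map (map_prod id (map f))) (feed srt k (alternate c (drop n (srt (b @ xs)))) ls)
    = feed srt' k (alternate c (drop n (srt' (map f b @ map f xs)))) (map (map_prod id (map f)) ls)" for c n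
  proof -
    have sub: "set (alternate c (drop n (srt (b @ xs)))) \<subseteq> S"
      using S set_alternate[of c "drop n (srt (b @ xs))"] set_drop_subset[of n "srt (b @ xs)"]
      unfolding assms(2) by (meson order_trans)
    have "map f (alternate c (drop n (srt (b @ xs)))) = alternate c (drop n (srt' (map f b @ map f xs)))"
      using assms(1)[OF S] by (simp add: map_alternate drop_map[symmetric])
    moreover have "\<forall>(bs, b) \<in> set ls. set b \<subseteq> S" using Cons.prems by simp
    ultimately show ?thesis using Cons.IH[OF sub] by metis
  qed
  have m: "map f (take n (srt (b @ xs))) = take n (srt' (map f b @ map f xs))" for n
    using assms(1)[OF S] by (simp add: take_map[symmetric])
  show ?case
  proof (cases "length (b @ xs) < k * (2 * length bs + 2)")
    case False
    let ?F = "map (map_prod id (map f))" and ?K = "k * kept bs"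
    have "map_pmf ?F (feed srt k xs (l # ls)) = bind_pmf (bernoulli_pmf (1/2)) (\<lambda>c.
        map_pmf (Cons (increment bs, take ?K (srt' (map f b @ map f xs))))
          (map_pmf ?F (feed srt k (alternate c (drop ?K (srt (b @ xs)))) ls)))"
      using False by (simp add: l map_bind_pmf map_pmf_comp m)
    also have "\<dots> = feed srt' k (map f xs) (?F (l # ls))"
      unfolding IH using False by (simp add: l)
    finally show ?thesis .
  qed (simp add: l)
qed simp

section \<open>Memory layout and the algorithm on slot numbers\<close>

fun slot_levels :: "nat \<Rightarrow> (bool list \<times> nat) list \<Rightarrow> nat level list" where
  "slot_levels i [] = []"
| "slot_levels i ((bs, n) # cs) = (bs, [i..<i + n]) # slot_levels (i + n) cs"

definition shape :: "'b level list \<Rightarrow> (bool list \<times> nat) list" where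
  "shape = map (map_prod id length)"

definition items :: "'b level list \<Rightarrow> 'b list" where
  "items ls = concat (map snd ls)"

text \<open>A numeric key for \<open>sort_key\<close> computed from the oracle alone; the set is
  finite for \<open>compare_slots\<close>, which is False outside the memory.\<close>

definition slot_rank :: "(nat \<Rightarrow> nat \<Rightarrow> bool) \<Rightarrow> nat \<Rightarrow> nat" where
  "slot_rank cmp i = card {j. cmp j i}"

fun weighted_count :: "(nat \<Rightarrow> bool) \<Rightarrow> nat \<Rightarrow> nat level list \<Rightarrow> real" where
  "weighted_count P g [] = 0"
| "weighted_count P g ((bs, b) # ls) = 2 ^ g * length (filter P b) + weighted_count P (Suc g) ls"

text \<open>The control state codes only counters and buffer lengths. Keeping the slots in the order
  \<open>items ls\<close> places the buffers consecutively from slot 1 on, where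
  \<open>slot_levels\<close> finds them again.\<close>

definition quantile_sketch :: "nat \<Rightarrow> comparison_algorithm" where
  "quantile_sketch k =
    \<lparr> start_control = to_nat ([] :: (bool list \<times> nat) list),
      step = (\<lambda>c cmp.
        map_pmf (\<lambda>ls. (to_nat (shape ls), items ls))
          (feed (sort_key (slot_rank cmp)) k [0] (slot_levels 1 (from_nat c)))),
      estimator = (\<lambda>c cmp. weighted_count (\<lambda>i. cmp i 0) 0 (slot_levels 1 (from_nat c))) \<rparr>"

definition encode :: "'a level list \<Rightarrow> 'a sketch" where
  "encode ls = (to_nat (shape ls), items ls)"

text \<open>The prefix \<open>zs\<close> stands for slot 0 and, within the induction, for the
  buffers of the lower levels.\<close>

lemma map_slot_levels:
  "length zs = i \<Longrightarrow>
   map (map_prod id (map ((!) (zs @ items ls)))) (slot_levels i (shape ls)) = ls"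
proof (induction ls arbitrary: i zs)
  case (Cons l ls)
  obtain bs b where l: "l = (bs, b)" by (cases l)
  have "map ((!) (zs @ b @ items ls)) [i..<i + length b] = b"
    using Cons.prems by (intro nth_equalityI) (auto simp: nth_append)
  then show ?case
    using Cons.IH[of "zs @ b" "i + length b"] Cons.prems by (simp add: l shape_def items_def)
qed (simp add: shape_def)

lemma set_slot_levels:
  "(bs, b) \<in> set (slot_levels i (shape ls)) \<Longrightarrow> set b \<subseteq> {i..<i + length (items ls)}"
proof (induction ls arbitrary: i)
  case (Cons l ls)
  obtain bs' b' where l: "l = (bs', b')" by (cases l)
  have "set b \<subseteq> {i + length b'..<i + length b' + length (items ls)}"
    if "(bs, b) \<in> set (slot_levels (i + length b') (shape ls))"
    using Cons.IH[OF that] .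
  then show ?case using Cons.prems by (fastforce simp: l shape_def items_def)
qed (simp add: shape_def)

text \<open>By transitivity and totality, the sets of slots below a given slot are nested, and
  strictly so for different items; their sizes therefore order the slots as the items are
  ordered.\<close>

lemma slot_rank_le_iff:
  assumes "i < length m" "j < length m"
  shows "slot_rank (compare_slots m) i \<le> slot_rank (compare_slots m) j \<longleftrightarrow> m ! i \<le> m ! j"
proof -
  have fin: "finite {l. compare_slots m l j}" for j
    by (rule finite_subset[of _ "{..<length m}"]) (auto simp: compare_slots_def)
  show ?thesis
  proof
    assume "m ! i \<le> m ! j"
    then show "slot_rank (compare_slots m) i \<le> slot_rank (compare_slots m) j"
      unfolding slot_rank_def using assms by (intro card_mono fin) (auto simp: compare_slots_def)
  next
    assume le: "slot_rank (compare_slots m) i \<le> slot_rank (compare_slots m) j"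
    show "m ! i \<le> m ! j"
    proof (rule ccontr)
      assume "\<not> m ! i \<le> m ! j"
      then have "{l. compare_slots m l j} \<subset> {l. compare_slots m l i}"
        using assms by (auto simp: compare_slots_def)
      then have "slot_rank (compare_slots m) j < slot_rank (compare_slots m) i"
        unfolding slot_rank_def by (intro psubset_card_mono fin)
      with le show False by simp
    qed
  qed
qed

text \<open>Both sides are sorted lists with the same multiset, so ties between slots holding equal
  items are harmless.\<close>

lemma map_nth_sort_slots:
  assumes "set l \<subseteq> {..<length m}"
  shows "map ((!) m) (sort_key (slot_rank (compare_slots m)) l) = sort (map ((!) m) l)"
proof -
  let ?r = "slot_rank (compare_slots m)"
  have "sorted_wrt (\<lambda>i j. ?r i \<le> ?r j) (sort_key ?r l)"
    using sorted_sort_key[of ?r l] by (simp add: sorted_map)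
  then have "sorted_wrt (\<lambda>i j. m ! i \<le> m ! j) (sort_key ?r l)"
    by (rule sorted_wrt_mono_rel[rotated]) (use assms in \<open>auto simp: slot_rank_le_iff subset_iff\<close>)
  then have "sorted (map ((!) m) (sort_key ?r l))" by (simp add: sorted_map)
  moreover have "mset (map ((!) m) (sort_key ?r l)) = mset (map ((!) m) l)"
    by simp
  ultimately show ?thesis by (metis properties_for_sort)
qed

text \<open>Ensures that only valid slots are returned, so that \<open>select_slots\<close> discards
  nothing.\<close>

lemma set_pmf_feed_subset:
  assumes "ls' \<in> set_pmf (feed srt k xs ls)" "\<And>l. set (srt l) = set l"
  shows "set (items ls') \<subseteq> set xs \<union> set (items ls)"
  using assms(1)
proof (induction ls arbitrary: xs ls')
  case Nil
  then show ?case by (simp add: items_def)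
next
  case (Cons l ls)
  obtain bs b where l: "l = (bs, b)" by (cases l)
  show ?case
  proof (cases "length (b @ xs) < k * (2 * length bs + 2)")
    case True
    then show ?thesis using Cons.prems by (auto simp: l items_def)
  next
    case False
    then obtain c ls'' where
      ls': "ls' = (increment bs, take (k * kept bs) (srt (b @ xs))) # ls''" and
      ls'': "ls'' \<in> set_pmf (feed srt k (alternate c (drop (k * kept bs) (srt (b @ xs)))) ls)"
      using Cons.prems by (auto simp: l)
    have "set (items ls'') \<subseteq> set (b @ xs) \<union> set (items ls)"
      using Cons.IH[OF ls''] set_alternate[of c "drop (k * kept bs) (srt (b @ xs))"]
        set_drop_subset[of "k * kept bs" "srt (b @ xs)"]
      unfolding assms(2) by blast
    moreover have "set (take (k * kept bs) (srt (b @ xs))) \<subseteq> set (b @ xs)"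
      using set_take_subset[of _ "srt (b @ xs)"] unfolding assms(2) .
    ultimately show ?thesis by (auto simp: ls' l items_def)
  qed
qed

text \<open>The run on slot numbers is carried to the run on items by the relabelling that reads the
  memory \<open>m\<close>.\<close>

lemma process_item_quantile_sketch:
  "process_item (quantile_sketch k) x (encode ls) = map_pmf encode (feed sort k [x] ls)"
proof -
  define m where "m = x # items ls"
  define sl where "sl = slot_levels 1 (shape ls)"
  let ?srt = "sort_key (slot_rank (compare_slots m))"
  have sl: "map (map_prod id (map ((!) m))) sl = ls"
    using map_slot_levels[of "[x]" 1 ls] by (simp add: m_def sl_def)
  have sub: "\<forall>(bs, b) \<in> set sl. set b \<subseteq> {..<length m}"
    using set_slot_levels[of _ _ 1 ls] by (fastforce simp: m_def sl_def)
  have "feed sort k [x] ls = feed sort k (map ((!) m) [0]) (map (map_prod id (map ((!) m))) sl)"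
    by (simp add: sl) (simp add: m_def)
  also have "\<dots> = map_pmf (map (map_prod id (map ((!) m)))) (feed ?srt k [0] sl)"
    using sub by (intro map_pmf_feed[symmetric] map_nth_sort_slots) (auto simp: m_def)
  finally have *: "map_pmf encode (feed sort k [x] ls)
    = map_pmf (\<lambda>ls. encode (map (map_prod id (map ((!) m))) ls)) (feed ?srt k [0] sl)"
    by (simp add: pmf.map_comp o_def)
  have "set (items sl) \<subseteq> {..<length m}" using sub by (fastforce simp: items_def)
  then have "set (items ls') \<subseteq> {..<length m}" if "ls' \<in> set_pmf (feed ?srt k [0] sl)" for ls'
    using set_pmf_feed_subset[OF that] by (auto simp: m_def)
  then have enc: "(to_nat (shape ls'), select_slots m (items ls'))
      = encode (map (map_prod id (map ((!) m))) ls')"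
    if "ls' \<in> set_pmf (feed ?srt k [0] sl)" for ls'
  proof -
    have "filter (\<lambda>i. i < length m) (items ls') = items ls'"
      using \<open>\<And>ls'. ls' \<in> _ \<Longrightarrow> _\<close>[OF that] by (auto simp: filter_id_conv)
    then show ?thesis
      by (auto simp: encode_def select_slots_def shape_def items_def map_concat o_def)
  qed
  show ?thesis
    unfolding * using enc
    by (auto simp: process_item_def quantile_sketch_def encode_def[of ls] m_def[symmetric] sl_def
        pmf.map_comp o_def intro!: map_pmf_cong)
qed

lemma sketch_of_quantile_sketch: "sketch_of (quantile_sketch k) xs = map_pmf encode (run k xs [])"
proof -
  have "process_stream (quantile_sketch k) xs (encode ls) = map_pmf encode (run k xs ls)" for ls
    by (induction xs arbitrary: ls)
      (simp_all add: process_item_quantile_sketch map_bind_pmf bind_map_pmf)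
  from this[of "[]"] show ?thesis
    by (simp add: sketch_of_def encode_def shape_def items_def quantile_sketch_def)
qed

lemma rank_estimate_quantile_sketch:
  "rank_estimate (quantile_sketch k) (encode ls) y = estimate y 0 ls"
proof -
  define m where "m = y # items ls"
  have "weighted_count (\<lambda>i. compare_slots m i 0) g sl = estimate y g (map (map_prod id (map ((!) m))) sl)"
    if "\<forall>(bs, b) \<in> set sl. set b \<subseteq> {..<length m}" for g sl
    using that
  proof (induction sl arbitrary: g)
    case (Cons l sl)
    obtain bs b where l: "l = (bs, b)" by (cases l)
    have "filter (\<lambda>i. compare_slots m i 0) b = filter (\<lambda>i. m ! i \<le> y) b"
      using Cons.prems by (intro filter_cong) (auto simp: l compare_slots_def m_def)
    then show ?case
      using Cons by (simp add: l count_le_def filter_map o_def)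
  qed simp
  moreover have "\<forall>(bs, b) \<in> set (slot_levels 1 (shape ls)). set b \<subseteq> {..<length m}"
    using set_slot_levels[of _ _ 1 ls] by (fastforce simp: m_def)
  moreover have "map (map_prod id (map ((!) m))) (slot_levels 1 (shape ls)) = ls"
    using map_slot_levels[of "[y]" 1 ls] by (simp add: m_def)
  ultimately show ?thesis
    by (simp add: rank_estimate_def encode_def quantile_sketch_def m_def[symmetric])
qed

section \<open>Size of the sketch\<close>

text \<open>Here n is the number of items that have entered the first level of the list.\<close>

fun size_inv :: "nat \<Rightarrow> real \<Rightarrow> 'b level list \<Rightarrow> bool" where
  "size_inv k n [] \<longleftrightarrow> 0 \<le> n"
| "size_inv k n ((bs, b) # ls) \<longleftrightarrow>
     real k * real (counter_value bs) + real (length b) \<le> n \<and>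
     (2::real) ^ length bs \<le> 2 * real (counter_value bs) + 1 \<and>
     (ls \<noteq> [] \<longrightarrow> bs \<noteq> []) \<and>
     size_inv k ((n - real (length b) + real (counter_value bs)) / 2) ls"

lemma size_inv_mono:
  fixes n n' :: real
  shows "size_inv k n ls \<Longrightarrow> n \<le> n' \<Longrightarrow> size_inv k n' ls"
proof (induction ls arbitrary: n n')
  case (Cons l ls)
  then show ?case by (cases l) (auto elim!: Cons.IH)
qed simp

lemma two_power_length_increment:
  assumes "(2::real) ^ length bs \<le> 2 * counter_value bs + 1"
  shows "(2::real) ^ length (increment bs) \<le> 2 * counter_value (increment bs) + 1"
proof (cases "length (increment bs) = length bs")
  case False
  then have *: "length (increment bs) = Suc (length bs)" "counter_value (increment bs) = 2 ^ length bs"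
    using length_increment[of bs] by auto
  then have "real (counter_value (increment bs)) = 2 ^ length bs" by simp
  with * show ?thesis by (simp del: counter_value_increment)
qed (use assms in simp)

text \<open>Each compaction removes at least k items, which gives the first inequality of
  \<open>size_inv\<close>. It promotes at most half of the removed items plus one half, and these
  halves add up to \<open>counter_value bs / 2\<close>.\<close>

lemma size_inv_feed:
  fixes n :: real
  assumes "0 < k" "\<And>l. length (srt l) = length l" "ls' \<in> set_pmf (feed srt k xs ls)" "size_inv k n ls"
  shows "size_inv k (n + length xs) ls'"
  using assms(3,4)
proof (induction ls arbitrary: n xs ls')
  case Nil
  then show ?case by simp
next
  case (Cons l ls)
  obtain bs b where l: "l = (bs, b)" by (cases l)
  note inv = Cons.prems(2)[unfolded l size_inv.simps]
  show ?case
  proof (cases "length (b @ xs) < k * (2 * length bs + 2)")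
    case True
    then show ?thesis using Cons.prems inv by (auto simp: l elim!: size_inv_mono)
  next
    case False
    define K where "K = k * kept bs"
    define zs where "zs = srt (b @ xs)"
    have zs: "length zs = length b + length xs" by (simp add: zs_def assms(2))
    obtain c ls'' where
      ls': "ls' = (increment bs, take K zs) # ls''" and
      ls'': "ls'' \<in> set_pmf (feed srt k (alternate c (drop K zs)) ls)"
      using Cons.prems False by (auto simp: l K_def zs_def)
    have "K + k \<le> k * (2 * length bs + 2)" using kept_le[of bs] mult_le_mono2[of "kept bs + 1" "2 * length bs + 2" k]
      by (simp add: K_def algebra_simps)
    then have K: "K + k \<le> length zs" using False zs by simp
    have "size_inv k ((n - length b + counter_value bs) / 2 + length (alternate c (drop K zs))) ls''"
      using Cons.IH[OF ls''] inv by blast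
    moreover have "real (length (alternate c (drop K zs))) \<le> (length zs - real K + 1) / 2"
    proof -
      have "2 * length (alternate c (drop K zs)) \<le> length zs - K + 1"
        unfolding length_alternate
        by (rule order_trans[OF times_div_less_eq_dividend]) simp
      then have "2 * length (alternate c (drop K zs)) + K \<le> length zs + 1" using K by linarith
      then have "real (2 * length (alternate c (drop K zs)) + K) \<le> real (length zs + 1)"
        by (simp only: of_nat_le_iff)
      then show ?thesis by simp
    qed
    ultimately have "size_inv k ((n + length xs - K + Suc (counter_value bs)) / 2) ls''"
      by (elim size_inv_mono) (simp add: zs field_simps)
    moreover have "real K + k \<le> length b + length xs" using K zs by (metis of_nat_add of_nat_le_iff)
    then have "k * Suc (counter_value bs) + real K \<le> n + length xs" using inv by (simp add: algebra_simps)
    ultimately show ?thesis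
      using two_power_length_increment[of bs] inv K by (simp add: ls' distrib_left)
  qed
qed

lemma size_inv_run:
  fixes n :: real
  assumes "0 < k" "ls' \<in> set_pmf (run k xs ls)" "size_inv k n ls"
  shows "size_inv k (n + length xs) ls'"
  using assms(2,3)
proof (induction xs arbitrary: ls n)
  case (Cons x xs)
  then obtain ls'' where 1: "ls'' \<in> set_pmf (feed sort k [x] ls)" and ls'': "ls' \<in> set_pmf (run k xs ls'')"
    by auto
  have "size_inv k (n + length [x]) ls''"
    by (rule size_inv_feed[OF assms(1) _ 1 Cons.prems(2)]) simp
  from Cons.IH[OF ls'' this] show ?case by (simp add: algebra_simps)
qed simp

text \<open>A counter value is at most \<open>n / k\<close>, hence at most \<open>n / 3\<close>, so
  at most \<open>2 / 3 * n\<close> items reach the next level. The last level but one has been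
  compacted, so at least k items entered it.\<close>

lemma size_inv_length:
  fixes n :: real
  assumes "3 \<le> k" "size_inv k n ls" "2 \<le> length ls"
  shows "k * (3 / 2) ^ (length ls - 2) \<le> n"
  using assms(2,3)
proof (induction ls arbitrary: n)
  case (Cons l ls)
  obtain bs b where l: "l = (bs, b)" by (cases l)
  have "bs \<noteq> []" using Cons.prems by (auto simp: l)
  then have "1 \<le> length bs" by (cases bs) auto
  then have "(2::real) ^ 1 \<le> 2 ^ length bs" by (intro power_increasing) auto
  then have "(2::real) \<le> 2 * counter_value bs + 1" using Cons.prems by (simp add: l)
  then have C: "1 \<le> real (counter_value bs)" by (cases "counter_value bs") auto
  have n: "k * counter_value bs + length b \<le> n" using Cons.prems by (simp add: l)
  show ?case
  proof (cases "2 \<le> length ls")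
    case True
    have "3 * real (counter_value bs) \<le> k * real (counter_value bs)"
      using assms(1) by (intro mult_right_mono) auto
    have "k * (3 / 2) ^ (length ls - 2) \<le> (n - length b + counter_value bs) / 2"
      using Cons.prems True by (intro Cons.IH) (auto simp: l)
    also have "(n - length b + counter_value bs) / 2 \<le> 2 / 3 * n"
      using n \<open>3 * _ \<le> _\<close> by simp
    finally have "k * (3 / 2) ^ (length ls - 2) \<le> 2 / 3 * n" by simp
    moreover have "length (l # ls) - 2 = Suc (length ls - 2)" using True by simp
    ultimately show ?thesis by simp
  next
    case False
    then have "length (l # ls) - 2 = 0" by simp
    have "real k * 1 \<le> k * real (counter_value bs)" using C by (intro mult_left_mono) auto
    with n False show ?thesis by simp
  qed
qed simp

lemma size_inv_counter_length:
  fixes n :: real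
  assumes "1 \<le> k" "size_inv k n ls" "(bs, b) \<in> set ls"
  shows "2 ^ length bs \<le> 2 * n / k + 1"
  using assms(2,3)
proof (induction ls arbitrary: n)
  case (Cons l ls)
  obtain bs' b' where l: "l = (bs', b')" by (cases l)
  have n: "k * counter_value bs' + length b' \<le> n" using Cons.prems by (simp add: l)
  show ?case
  proof (cases "(bs, b) = l")
    case True
    then have "k * real (counter_value bs) \<le> n" using n by (simp add: l)
    then have "counter_value bs \<le> n / k" using assms(1) by (simp add: field_simps)
    moreover have "(2::real) ^ length bs \<le> 2 * counter_value bs + 1" using Cons.prems True l by simp
    ultimately show ?thesis by simp
  next
    case False
    then have "2 ^ length bs \<le> 2 * ((n - length b' + counter_value bs') / 2) / k + 1"
      using Cons.prems by (intro Cons.IH) (auto simp: l)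
    moreover have "1 * real (counter_value bs') \<le> k * real (counter_value bs')"
      using assms(1) by (intro mult_right_mono) auto
    then have "2 * ((n - length b' + counter_value bs') / 2) \<le> 2 * n" using n by simp
    then have "2 * ((n - length b' + counter_value bs') / 2) / k \<le> 2 * n / k"
      by (rule divide_right_mono) simp
    ultimately show ?thesis by simp
  qed
qed simp

text \<open>
  The second argument of the maximum is needed for a freshly created level, which receives a
  batch of items from below without being compacted.
\<close>

definition buffer_bound :: "nat \<Rightarrow> nat \<Rightarrow> bool list \<Rightarrow> nat" where
  "buffer_bound k S bs = max (k * (2 * length bs + 2)) (k * (S + 1))"

text \<open>The batch size \<open>k * (S + 1)\<close> reproduces itself: a buffer exceeds the part
  to be kept by at most this much before a batch arrives, by at most twice as much afterwards, and
  half of the excess moves up.\<close>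

lemma buffer_bound_feed:
  assumes "\<And>l. length (srt l) = length l" "0 < k"
    "ls' \<in> set_pmf (feed srt k xs ls)" "length xs \<le> k * (S + 1)"
    "\<forall>(bs, b) \<in> set ls. length bs \<le> S \<and> length b \<le> buffer_bound k S bs"
  shows "\<forall>(bs, b) \<in> set ls'. length b \<le> buffer_bound k S bs"
  using assms(3-5)
proof (induction ls arbitrary: xs ls')
  case Nil
  then show ?case by (simp add: buffer_bound_def)
next
  case (Cons l ls)
  obtain bs b where l: "l = (bs, b)" by (cases l)
  show ?case
  proof (cases "length (b @ xs) < k * (2 * length bs + 2)")
    case True
    then show ?thesis using Cons.prems by (auto simp: l buffer_bound_def)
  next
    case False
    define K where "K = k * kept bs"
    define zs where "zs = srt (b @ xs)"
    have zs: "length zs = length b + length xs" by (simp add: zs_def assms(1))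
    obtain c ls'' where
      ls': "ls' = (increment bs, take K zs) # ls''" and
      ls'': "ls'' \<in> set_pmf (feed srt k (alternate c (drop K zs)) ls)"
      using Cons.prems False by (auto simp: l K_def zs_def)
    have S: "length bs \<le> S" "length b \<le> buffer_bound k S bs" using Cons.prems by (auto simp: l)
    have "k * (2 * length bs + 2) \<le> K + k * (S + 1)"
    proof -
      have "2 * length bs + 2 \<le> kept bs + (S + 1)" using kept_ge[of bs] S by simp
      then have "k * (2 * length bs + 2) \<le> k * (kept bs + (S + 1))" by (rule mult_le_mono2)
      then show ?thesis by (simp only: K_def distrib_left)
    qed
    then have "length b \<le> K + k * (S + 1)" using S(2) by (simp add: buffer_bound_def)
    then have "length zs - K \<le> 2 * (k * (S + 1))" using zs Cons.prems by simp
    then have "length (alternate c (drop K zs)) \<le> (2 * (k * (S + 1)) + 1) div 2"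
      unfolding length_alternate by (intro div_le_mono add_mono) (simp_all del: mult_Suc_right)
    \<comment> \<open>Rounding up does no harm, because the bound being halved is even.\<close>
    then have "length (alternate c (drop K zs)) \<le> k * (S + 1)"
      by (metis Suc_eq_plus1 even_Suc_div_two even_mult_iff even_numeral nonzero_mult_div_cancel_left zero_neq_numeral)
    then have IH: "\<forall>(bs, b) \<in> set ls''. length b \<le> buffer_bound k S bs"
      using Cons.prems by (intro Cons.IH[OF ls'']) auto
    have "K \<le> k * (2 * length bs + 2)" unfolding K_def
      using kept_le[of bs] by (intro mult_le_mono2) simp
    moreover have "length bs \<le> length (increment bs)" using length_increment[of bs] by auto
    then have "k * (2 * length bs + 2) \<le> k * (2 * length (increment bs) + 2)" by (intro mult_le_mono2) simp
    ultimately have "K \<le> buffer_bound k S (increment bs)"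
      unfolding buffer_bound_def by (meson le_trans max.coboundedI1)
    then have "length (take K zs) \<le> buffer_bound k S (increment bs)" by simp
    with IH show ?thesis by (simp add: ls')
  qed
qed

lemma buffer_bound_run:
  fixes n :: real
  assumes "0 < k" "ls' \<in> set_pmf (run k xs ls)" "size_inv k n ls" "2 * (n + length xs) / k + 1 < 2 ^ Suc S"
    "\<forall>(bs, b) \<in> set ls. length b \<le> buffer_bound k S bs"
  shows "\<forall>(bs, b) \<in> set ls'. length b \<le> buffer_bound k S bs"
  using assms(2-)
proof (induction xs arbitrary: ls n)
  case (Cons x xs)
  then obtain ls'' where 1: "ls'' \<in> set_pmf (feed sort k [x] ls)" and ls'': "ls' \<in> set_pmf (run k xs ls'')"
    by auto
  have "size_inv k (n + length [x]) ls''"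
    by (rule size_inv_feed[OF assms(1) _ 1 Cons.prems(2)]) simp
  then have 2: "size_inv k (n + 1) ls''" by simp
  have "length bs \<le> S" if "(bs, b) \<in> set ls" for bs b
  proof -
    have "2 ^ length bs \<le> 2 * n / k + 1"
      using size_inv_counter_length[OF _ _ that] Cons.prems assms(1) by simp
    also have "\<dots> \<le> 2 * (n + length (x # xs)) / k + 1" by (simp add: divide_right_mono)
    finally have "(2::real) ^ length bs < 2 ^ Suc S" using Cons.prems by simp
    then show ?thesis by (simp del: power_Suc)
  qed
  then have "\<forall>(bs, b) \<in> set ls''. length b \<le> buffer_bound k S bs"
    using Cons.prems assms(1) by (intro buffer_bound_feed[OF _ assms(1) 1]) auto
  with Cons.IH[OF ls'' 2] Cons.prems show ?case by (simp add: algebra_simps)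
qed simp

text \<open>There are at most \<open>4 * L\<close> levels of at most \<open>k * (2 * S + 2)\<close>
  items, and \<open>S <= 3 * L\<close> makes the latter at most \<open>8 * k * L\<close>; this gives
  32.\<close>

lemma length_items_run:
  fixes xs :: "'a::linorder list"
  assumes k: "3 \<le> k" and ls: "ls \<in> set_pmf (run k xs [])" and L: "1 \<le> L" "log 2 (length xs / k) \<le> L"
  shows "length (items ls) \<le> 32 * real k * L\<^sup>2"
proof -
  define S where "S = nat \<lfloor>log 2 (2 * length xs / k + 1)\<rfloor>"
  have pos: "1 \<le> 2 * length xs / k + 1" by simp
  then have pos0: "0 < 2 * length xs / k + 1" by linarith
  have inv: "size_inv k (length xs) ls"
    using size_inv_run[OF _ ls, of 0] k by simp
  have "0 \<le> log 2 (2 * length xs / k + 1)"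
    using pos pos0 by (subst zero_le_log_cancel_iff) auto
  then have lg: "real S \<le> log 2 (2 * length xs / k + 1)" "log 2 (2 * length xs / k + 1) < S + 1"
    unfolding S_def by linarith+
  then have "2 * length xs / k + 1 < 2 powr (real (Suc S))"
    using pos0 by (simp add: log_less_iff add.commute)
  then have "2 * (0 + length xs) / k + 1 < 2 ^ Suc S" by (simp only: powr_realpow) simp
  then have bb: "\<forall>(bs, b) \<in> set ls. length b \<le> buffer_bound k S bs"
    using k by (intro buffer_bound_run[OF _ ls, of 0]) auto
  have sS: "length bs \<le> S" if "(bs, b) \<in> set ls" for bs b
  proof -
    have "(2::real) ^ length bs \<le> 2 * length xs / k + 1"
      using size_inv_counter_length[OF _ inv that] k by simp
    also have "\<dots> < 2 ^ Suc S" using \<open>2 * (0 + length xs) / k + 1 < 2 ^ Suc S\<close> by simp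
    finally show ?thesis by (simp del: power_Suc)
  qed
  have "length b \<le> k * (2 * S + 2)" if "(bs, b) \<in> set ls" for bs b
  proof -
    have "length b \<le> buffer_bound k S bs" using bb that by auto
    also have "\<dots> \<le> k * (2 * S + 2)"
      unfolding buffer_bound_def using sS[OF that] by (intro max.boundedI mult_le_mono2) auto
    finally show ?thesis .
  qed
  then have "length (items ls) \<le> length ls * (k * (2 * S + 2))"
  proof (induction ls)
    case (Cons l ls)
    obtain bs b where l: "l = (bs, b)" by (cases l)
    have "length b \<le> k * (2 * S + 2)" using Cons.prems l by auto
    moreover have "length (items ls) \<le> length ls * (k * (2 * S + 2))" using Cons by auto
    ultimately show ?case by (simp add: l items_def)
  qed (simp add: items_def)
  then have tot: "real (length (items ls)) \<le> length ls * (k * (2 * real S + 2))"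
    by (metis (mono_tags, lifting) of_nat_add of_nat_le_iff of_nat_mult of_nat_numeral)
  have "length xs / k \<le> 2 powr L"
  proof (cases "xs = []")
    case False
    then have "0 < length xs / k" using k by simp
    then have "2 powr log 2 (length xs / k) = length xs / k" by simp
    with L show ?thesis by (metis one_le_numeral powr_mono)
  qed simp
  have L2: "2 powr 1 \<le> 2 powr L" using L by (intro powr_mono) auto
  have "2 * length xs / k + 1 \<le> 2 powr L * 2 powr 2"
    using \<open>length xs / k \<le> 2 powr L\<close> L2 by simp
  also have "\<dots> = 2 powr (L + 2)" by (simp add: powr_add)
  finally have "log 2 (2 * length xs / k + 1) \<le> L + 2" using pos0 by (simp add: log_le_iff)
  then have S: "real S \<le> 3 * L" using lg L by simp
  have len: "real (length ls) \<le> 4 * L"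
  proof (cases "2 \<le> length ls")
    case True
    have "k * (3 / 2) ^ (length ls - 2) \<le> length xs" by (rule size_inv_length[OF k inv True])
    then have "(3 / 2) ^ (length ls - 2) \<le> length xs / k" using k by (simp add: field_simps)
    also have "\<dots> \<le> 2 powr L" by fact
    \<comment> \<open>Squaring replaces the base \<open>3 / 2\<close> by \<open>9 / 4\<close>, which
      is at least 2, at the price of doubling \<open>L\<close>.\<close>
    finally have "((3 / 2) ^ (length ls - 2))\<^sup>2 \<le> (2 powr L)\<^sup>2" by (intro power_mono) auto
    moreover have "(2::real) ^ (length ls - 2) \<le> ((3 / 2)\<^sup>2) ^ (length ls - 2)"
      by (intro power_mono) (auto simp: power2_eq_square)
    ultimately have "2 ^ (length ls - 2) \<le> (2 powr L)\<^sup>2"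
      by (simp flip: power_mult add: mult.commute)
    also have "\<dots> = 2 powr (2 * L)" by (simp add: power2_eq_square flip: powr_add)
    finally have "2 powr real (length ls - 2) \<le> 2 powr (2 * L)" by (simp add: powr_realpow)
    then have "real (length ls - 2) \<le> 2 * L" by simp
    then show ?thesis using L True by simp
  qed (use L in simp)
  have "length ls * (k * (2 * real S + 2)) \<le> (4 * L) * (k * (2 * (3 * L) + 2 * L))"
    using len S L by (intro mult_mono mult_left_mono) auto
  with tot show ?thesis by (simp add: power2_eq_square algebra_simps)
qed

section \<open>Choice of the parameters\<close>

text \<open>Removing the top term, which is at most 1, halves \<open>x * 2 ^ H\<close>; after at
  most l removals a geometric series of sum at most 1 is left.\<close>

lemma sum_min_geometric_le:
  fixes x :: real
  assumes "0 \<le> x" "x * 2 ^ H \<le> 2 ^ l"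
  shows "(\<Sum>i<H. min 1 (x * 2 ^ i)) \<le> l + 1"
  using assms(2)
proof (induction l arbitrary: H)
  case 0
  have "(\<Sum>i<H. min 1 (x * 2 ^ i)) \<le> (\<Sum>i<H. x * 2 ^ i)" by (intro sum_mono) simp
  also have "\<dots> = x * 2 ^ H - x"
    by (simp add: sum_distrib_left[symmetric] geometric_sum algebra_simps)
  finally show ?case using 0 assms(1) by simp
next
  case (Suc l)
  show ?case
  proof (cases H)
    case (Suc H')
    then have "(\<Sum>i<H'. min 1 (x * 2 ^ i)) \<le> l + 1" using Suc.prems by (intro Suc.IH) simp
    then show ?thesis by (simp add: Suc min_def)
  qed simp
qed

text \<open>Integrality makes a nonzero estimate at least 1, as the case of rank 0 requires.\<close>

lemma estimate_eq_of_nat: "\<exists>n::nat. estimate y g ls = real n"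
proof (induction y g ls rule: estimate.induct)
  case (2 y g bs b ls)
  then obtain n where "estimate y (Suc g) ls = real n" by blast
  then have "estimate y g ((bs, b) # ls) = real (2 ^ g * count_le y b + n)" by simp
  then show ?case by blast
qed (simp add: exI[of _ 0])

lemma estimate_accuracy:
  fixes \<epsilon> \<delta> :: real
  assumes \<delta>: "0 < \<delta>" "\<delta> \<le> 1 / 2" and \<epsilon>: "0 < \<epsilon>" "\<epsilon> \<le> 1"
    and l: "8 * ln (2 / \<delta>) \<le> 2 ^ l" and k: "4 / \<epsilon> * (l + 1) \<le> real k"
  shows "1 - \<delta> \<le> measure_pmf.prob (run k xs [])
    {ls. \<bar>estimate y 0 ls - count_le y xs\<bar> \<le> \<epsilon> * count_le y xs}"
proof -
  define R where "R = real (count_le y xs)"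
  have "1 / \<epsilon> * 1 \<le> 4 / \<epsilon> * (l + 1)" using \<epsilon> by (intro mult_mono divide_right_mono) auto
  then have kinv: "1 / \<epsilon> \<le> real k" using k by simp
  moreover have "1 \<le> 1 / \<epsilon>" using \<epsilon> by simp
  ultimately have "1 \<le> real k" by linarith
  then have k1: "0 < k" by simp
  have lnp: "0 < ln (2 / \<delta>)" using \<delta> by (simp add: field_simps)
  have exp_ln: "exp (- ln (2 / \<delta>)) = \<delta> / 2" using \<delta> by (simp add: exp_minus)
  have "\<exists>D U. measure_pmf.prob (run k xs []) {ls. estimate y 0 ls \<le> D \<or> U \<le> estimate y 0 ls} \<le> \<delta>
     \<and> (\<forall>ls. \<epsilon> * R < \<bar>estimate y 0 ls - R\<bar> \<longrightarrow> estimate y 0 ls \<le> D \<or> U \<le> estimate y 0 ls)"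
  proof (cases "count_le y xs = 0")
    case True
    \<comment> \<open>Rank 0 demands an exact estimate. With \<open>H = 0\<close> there is no drift,
      and each of the thresholds -1 and 1 contributes \<open>\<delta> / 2\<close>.\<close>
    define lam where "lam = ln (2 / \<delta>)"
    interpret potential y k 0 lam by standard (use k1 lnp in \<open>auto simp: lam_def\<close>)
    have "measure_pmf.prob (run k xs []) {ls. estimate y 0 ls \<le> - 1 \<or> 1 \<le> estimate y 0 ls} \<le> \<delta>"
      using prob_estimate_le[of 1 xs "- 1"] \<open>1 \<le> real k\<close> exp_ln True by (simp add: lam_def)
    moreover have "1 \<le> estimate y 0 ls" if "estimate y 0 ls \<noteq> 0" for ls
      using estimate_eq_of_nat[of y 0 ls] that by auto
    ultimately show ?thesis using True by (intro exI[of _ "- 1"] exI[of _ 1]) (auto simp: R_def)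
  next
    case False
    then have R: "1 \<le> R" by (simp add: R_def)
    \<comment> \<open>Makes \<open>lam * \<epsilon> * R\<close> equal to
      \<open>2 * ln (2 / \<delta>)\<close>: one half absorbs the drift, the other brings each tail
      down to \<open>\<delta> / 2\<close>.\<close>
    define lam where "lam = 2 * ln (2 / \<delta>) / (\<epsilon> * R)"
    \<comment> \<open>\<open>2 ^ H * k\<close> has to reach the upper threshold
      \<open>(1 + \<epsilon>) * R\<close>, which is at most \<open>2 * R\<close>; minimality keeps
      it at most \<open>4 * R\<close> when \<open>H\<close> is positive.\<close>
    define H where "H = (LEAST H. 2 * R \<le> 2 ^ H * real k)"
    have "\<exists>H. 2 * R \<le> 2 ^ H * real k"
    proof -
      obtain H where "2 * R < 2 ^ H" using real_arch_pow[of 2 "2 * R"] by auto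
      also have "(2::real) ^ H \<le> 2 ^ H * real k" using \<open>1 \<le> real k\<close> by simp
      finally show ?thesis by (intro exI[of _ H]) simp
    qed
    then have H: "2 * R \<le> 2 ^ H * real k" unfolding H_def by (rule LeastI_ex)
    have lam: "0 \<le> lam" using lnp \<epsilon> R by (simp add: lam_def)
    have "(\<Sum>i<H. min 1 (lam * 2 ^ i)) \<le> l + 1"
    proof (cases H)
      case (Suc H')
      then have "\<not> 2 * R \<le> 2 ^ H' * real k" unfolding H_def by (intro not_less_Least) (simp add: H_def[symmetric])
      then have "2 ^ H' * real k \<le> 2 * R" by (rule less_imp_le[OF not_le_imp_less])
      moreover have "2 ^ H * real k = 2 * (2 ^ H' * real k)" by (simp add: Suc)
      ultimately have "2 ^ H * real k \<le> 4 * R" by linarith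
      then have "lam * (2 ^ H * real k) \<le> lam * (4 * R)" using lam by (rule mult_left_mono)
      also have "\<dots> = 8 * ln (2 / \<delta>) / \<epsilon>" using R by (simp add: lam_def)
      also have "\<dots> \<le> 2 ^ l / \<epsilon>" using l \<epsilon> by (intro divide_right_mono) auto
      also have "\<dots> = 2 ^ l * (1 / \<epsilon>)" by simp
      also have "\<dots> \<le> 2 ^ l * real k" using kinv by (intro mult_left_mono) auto
      finally have "lam * 2 ^ H \<le> 2 ^ l" using k1 by simp
      with lam show ?thesis by (rule sum_min_geometric_le)
    qed simp
    then have "2 * lam / k * (\<Sum>i<H. min 1 (lam * 2 ^ i)) \<le> 2 * lam / k * (l + 1)"
      using lam by (intro mult_left_mono) auto
    also have "\<dots> \<le> lam * \<epsilon> / 2"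
    proof -
      have "4 * (l + 1) \<le> \<epsilon> * k" using k \<epsilon> by (simp add: field_simps)
      then have "lam * (4 * (l + 1)) \<le> lam * (\<epsilon> * k)" using lam by (rule mult_left_mono)
      then show ?thesis using k1 by (simp add: field_simps)
    qed
    finally have dr: "2 * lam / k * (\<Sum>i<H. min 1 (lam * 2 ^ i)) \<le> lam * \<epsilon> / 2" .
    moreover have "lam * \<epsilon> \<le> lam * 1" using lam \<epsilon> by (intro mult_left_mono)
    ultimately have "2 * lam / k * (\<Sum>i<H. min 1 (lam * 2 ^ i)) \<le> lam"
      using mult_nonneg_nonneg[of lam \<epsilon>] lam \<epsilon> by linarith
    then interpret potential y k H lam by unfold_locales (use k1 lam in auto)
    have "drift 0 * R \<le> lam * \<epsilon> / 2 * R" using dr R by (intro mult_right_mono) (auto simp: drift_0)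
    moreover have "lam * \<epsilon> * R = 2 * ln (2 / \<delta>)" using \<epsilon> R by (simp add: lam_def)
    ultimately have ex: "drift 0 * R - lam * \<epsilon> * R \<le> - ln (2 / \<delta>)" by simp
    have "(1 + \<epsilon>) * R \<le> 2 * R" using \<epsilon> R by (intro mult_right_mono) auto
    then have "measure_pmf.prob (run k xs [])
        {ls. estimate y 0 ls \<le> (1 - \<epsilon>) * R \<or> (1 + \<epsilon>) * R \<le> estimate y 0 ls}
      \<le> exp ((lam + drift 0) * R - lam * ((1 + \<epsilon>) * R)) + exp (lam * ((1 - \<epsilon>) * R) - (lam - drift 0) * R)"
      unfolding R_def using H by (intro prob_estimate_le) (simp add: R_def)
    also have "\<dots> = 2 * exp (drift 0 * R - lam * \<epsilon> * R)" by (simp add: algebra_simps)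
    also have "\<dots> \<le> 2 * exp (- ln (2 / \<delta>))" using ex by simp
    also have "\<dots> = \<delta>" by (simp add: exp_ln)
    finally show ?thesis
      by (intro exI[of _ "(1 - \<epsilon>) * R"] exI[of _ "(1 + \<epsilon>) * R"]) (auto simp: algebra_simps abs_if split: if_splits)
  qed
  then obtain D U where
    DU: "measure_pmf.prob (run k xs []) {ls. estimate y 0 ls \<le> D \<or> U \<le> estimate y 0 ls} \<le> \<delta>"
      "\<And>ls. \<epsilon> * R < \<bar>estimate y 0 ls - R\<bar> \<Longrightarrow> estimate y 0 ls \<le> D \<or> U \<le> estimate y 0 ls"
    by blast
  let ?G = "{ls. \<bar>estimate y 0 ls - R\<bar> \<le> \<epsilon> * R}"
  have "measure_pmf.prob (run k xs []) (- ?G)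
      \<le> measure_pmf.prob (run k xs []) {ls. estimate y 0 ls \<le> D \<or> U \<le> estimate y 0 ls}"
    by (intro measure_pmf.finite_measure_mono) (auto simp: not_le dest!: DU(2))
  moreover have "measure_pmf.prob (run k xs []) (- ?G) = 1 - measure_pmf.prob (run k xs []) ?G"
    using measure_pmf.prob_compl[of ?G "run k xs []"] by (simp add: Compl_eq_Diff_UNIV)
  ultimately show ?thesis using DU(1) by (simp add: R_def)
qed

text \<open>The algorithm depends on \<epsilon> and \<delta> only through k, and not on the stream
  or its length. The factor 32 is that of \<open>length_items_run\<close>, and 29 bounds k.\<close>

lemma exists_quantile_sketch:
  fixes \<epsilon> \<delta> :: real
  assumes \<delta>: "0 < \<delta>" "\<delta> \<le> 1 / 2" and \<epsilon>: "0 < \<epsilon>" "\<epsilon> \<le> 1"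
  shows "\<exists>A. \<forall>xs::'a::linorder list.
          (\<forall>s \<in> set_pmf (sketch_of A xs).
             real (sketch_items s) \<le> 32 * 29 * sketch_bound \<epsilon> \<delta> (length xs)) \<and>
          (\<forall>y.
             measure_pmf.prob (sketch_of A xs)
               {s. \<bar>rank_estimate A s y - real (stream_rank xs y)\<bar>
                     \<le> \<epsilon> * real (stream_rank xs y)} \<ge> 1 - \<delta>)"
proof -
  define L where "L = log 2 (1 / \<delta>)"
  define M where "M = max 1 (log 2 L)"
  \<comment> \<open>Since \<open>ln (2 / \<delta>) <= 2 * L\<close>, it suffices that
    \<open>2 ^ l\<close> is at least \<open>16 * L\<close>.\<close>
  define l where "l = 4 + nat \<lceil>log 2 L\<rceil>"
  define k where "k = nat \<lceil>4 / \<epsilon> * (l + 1)\<rceil>"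
  have "log 2 2 \<le> L" unfolding L_def using \<delta> by (intro log_mono) (auto simp: field_simps)
  then have L: "1 \<le> L" by simp
  then have "0 \<le> log 2 L" by simp
  then have lM: "real l \<le> 5 + log 2 L" "0 \<le> log 2 L" unfolding l_def by linarith+
  have "L = 2 powr (log 2 L)" using L by simp
  also have "\<dots> \<le> 2 powr (real (nat \<lceil>log 2 L\<rceil>))" by (intro powr_mono real_nat_ceiling_ge) simp
  finally have L2: "16 * L \<le> 2 ^ l" by (simp add: l_def power_add powr_realpow)
  have "ln (2 / \<delta>) = ln 2 * (1 + L)" using \<delta> by (simp add: L_def log_def ln_div field_simps)
  also have "\<dots> \<le> 1 * (2 * L)" using L ln_2_less_1 by (intro mult_mono) auto
  finally have l8: "8 * ln (2 / \<delta>) \<le> 2 ^ l" using L2 by simp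
  have k: "4 / \<epsilon> * (l + 1) \<le> real k" unfolding k_def by (rule real_nat_ceiling_ge)
  have "4 \<le> 4 / \<epsilon>" using \<epsilon> by (simp add: field_simps)
  then have k4: "4 * 1 \<le> 4 / \<epsilon> * (l + 1)" using \<epsilon> by (intro mult_mono) auto
  then have "4 \<le> real k" using k by simp
  then have k3: "3 \<le> k" by simp
  have M: "1 \<le> M" "log 2 L \<le> M" by (auto simp: M_def)
  have "1 \<le> 1 / \<epsilon>" using \<epsilon> by (simp add: field_simps)
  have "1 / \<epsilon> * 1 \<le> 4 / \<epsilon> * (l + 1)" using \<epsilon> by (intro mult_mono divide_right_mono) auto
  then have kinv: "1 / \<epsilon> \<le> real k" using k by simp
  have "real k \<le> 4 / \<epsilon> * (l + 1) + 1"
    using k4 unfolding k_def by linarith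
  \<comment> \<open>Here 29 arises as \<open>4 * 7 + 1\<close>: \<open>l + 1\<close> is at most
    \<open>6 + log 2 L\<close>, hence at most \<open>7 * M\<close>, and rounding k up costs at most
    1.\<close>
  also have "\<dots> \<le> 4 / \<epsilon> * (7 * M) + 1 / \<epsilon> * M"
  proof (intro add_mono mult_left_mono)
    show "real (l + 1) \<le> 7 * M" using lM M by simp
    show "1 \<le> 1 / \<epsilon> * M" using mult_mono[OF \<open>1 \<le> 1 / \<epsilon>\<close> M(1)] \<epsilon> by simp
  qed (use \<epsilon> in auto)
  also have "\<dots> = 29 * (1 / \<epsilon> * M)" by simp
  finally have kM: "real k \<le> 29 * (1 / \<epsilon> * M)" .
  show ?thesis
  proof (intro exI[of _ "quantile_sketch k"] allI conjI ballI)
    fix xs :: "'a list" and s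
    assume "s \<in> set_pmf (sketch_of (quantile_sketch k) xs)"
    then obtain ls where ls: "ls \<in> set_pmf (run k xs [])" and s: "s = encode ls"
      by (auto simp: sketch_of_quantile_sketch)
    define N where "N = max 1 (log 2 (\<epsilon> * length xs))"
    have "log 2 (length xs / k) \<le> N"
    proof (cases "xs = []")
      case False
      have "1 \<le> \<epsilon> * k" using kinv \<epsilon> by (simp add: field_simps)
      then have "real (length xs) * 1 \<le> length xs * (\<epsilon> * k)" by (intro mult_left_mono) auto
      then have "length xs / k \<le> \<epsilon> * length xs" using k3 by (simp add: field_simps)
      then have "log 2 (length xs / k) \<le> log 2 (\<epsilon> * length xs)"
        using False k3 \<epsilon> by (subst log_le_cancel_iff) auto
      then show ?thesis by (simp add: N_def)
    \<comment> \<open>For the empty stream both logarithms are taken at 0, so the inequality holds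
      whatever the value there.\<close>
    qed (simp add: N_def log_def)
    then have "real (length (items ls)) \<le> 32 * real k * N\<^sup>2"
      by (intro length_items_run[OF k3 ls]) (auto simp: N_def)
    also have "\<dots> \<le> 32 * (29 * (1 / \<epsilon> * M)) * N\<^sup>2"
      using kM by (intro mult_right_mono mult_left_mono) auto
    also have "\<dots> = 32 * 29 * sketch_bound \<epsilon> \<delta> (length xs)"
      by (simp add: sketch_bound_def M_def N_def L_def)
    finally show "real (sketch_items s) \<le> 32 * 29 * sketch_bound \<epsilon> \<delta> (length xs)"
      by (simp add: s sketch_items_def encode_def)
  next
    fix xs :: "'a list" and y
    show "measure_pmf.prob (sketch_of (quantile_sketch k) xs)
        {s. \<bar>rank_estimate (quantile_sketch k) s y - real (stream_rank xs y)\<bar>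
          \<le> \<epsilon> * real (stream_rank xs y)} \<ge> 1 - \<delta>"
      using estimate_accuracy[OF \<delta> \<epsilon> l8 k, of xs y]
      by (simp add: sketch_of_quantile_sketch vimage_def rank_estimate_quantile_sketch stream_rank_eq_count_le)
  qed
qed

theorem theorem2:
  "\<exists>C::real. C > 0 \<and>
     (\<forall>(\<epsilon>::real) (\<delta>::real). 0 < \<delta> \<and> \<delta> \<le> 1 / 2 \<and> 0 < \<epsilon> \<and> \<epsilon> \<le> 1 \<longrightarrow>
       (\<exists>A::comparison_algorithm. \<forall>xs::'a::linorder list.
          (\<forall>s \<in> set_pmf (sketch_of A xs).
             real (sketch_items s) \<le> C * sketch_bound \<epsilon> \<delta> (length xs)) \<and>
          (\<forall>y::'a.
             measure_pmf.prob (sketch_of A xs)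
               {s. \<bar>rank_estimate A s y - real (stream_rank xs y)\<bar>
                     \<le> \<epsilon> * real (stream_rank xs y)} \<ge> 1 - \<delta>)))"
proof (intro exI[of _ "32 * 29"] conjI)
  show "0 < (32 * 29 :: real)" by simp
qed (blast intro: exists_quantile_sketch)

end
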